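(* Let $q$ be a prime power and $n\ge2$ with $\gcd(q,n)=1$, and use the notation of the context. Then for any code (left ideal) $I\subset\mathbb{F}_qD_n$ we have $$\mathcal{P}(I)=\bigoplus_{j=1}^{r+s}B_j,\qquad B_j=\begin{cases}A_j,&j\in J_1\\ I_j(0,1),&j\in J_2\\ I_j(1,0),&j\in J_3\\ I_j(-x_j,1),&j\in J_4\\ 0,&j\notin J_1\cup J_2\cup J_3\cup J_4,\end{cases}$$ where $x_j\in F_j$, $x_j\neq0$, and $J_1,J_2,J_3,J_4$ are pairwise disjoint sets such that $J_1,J_2,J_3\subset\{1,\dots,r+s\}$, $J_4\subset\{\zeta(n)+1,\dots,r+s\}$, and $1\notin J_2$ if $q$ is even. On the other hand, for any $x_j,y_j\in F_j$ and for any $B_j$ such that $B_j=A_j$ or $B_j=I_j(x_j,y_j)$ or $B_j=0$ ($1\le j\le r+s$), the set $\mathcal{P}^{-1}\left(\bigoplus_{j=1}^{r+s}B_j\right)$ is a $D_n$-code.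
   Context: $D_n=\langle a,b\mid a^n=1,\ b^2=1,\ bab=a^{-1}\rangle$ is the dihedral group of order $2n$, $\mathbb{F}_qD_n$ its group algebra; every element is uniquely $P(a)+bQ(a)$ with $P,Q\in\mathbb{F}_q[x]$ of degree less than $n$. A dihedral code ($D_n$-code) is a left ideal of $\mathbb{F}_qD_n$. For $g\in\mathbb{F}_q[x]$ with $g(0)\neq0$ put $g^*(x)=x^{\deg g}g(x^{-1})$. Factor $x^n-1$ over $\mathbb{F}_q$ into (pairwise distinct) monic irreducible factors as $x^n-1=(f_1f_2\cdots f_r)(f_{r+1}f_{r+1}^*\cdots f_{r+s}f_{r+s}^* )$, where $f_1=x-1$, $f_2=x+1$ if $n$ is even, $f_j^*=f_j$ for $1<j\le r$, and for $j>r$ the polynomials $f_j$ and $f_j^*$ have different roots (here the factor $f_j^*$, $j>r$, is normalized by a scalar to be monic). Let $\alpha_j$ be a root of $f_j$. Let $\zeta(n)=1$ if $n$ is odd, $\zeta(n)=2$ if $n$ is even. $\langle h\mid h^2\rangle$ is the cyclic group of order 2 generated by $h$. Put $F_j=\mathbb{F}_q$ for $1\le j\le\zeta(n)$, $F_j=\mathbb{F}_q[\alpha_j+\alpha_j^{-1}]$ for $\zeta(n)+1\le j\le r$, $F_j=\mathbb{F}_q[\alpha_j]$ for $r+1\le j\le r+s$. Put $A_j=\mathbb{F}_q\langle h\mid h^2\rangle$ for $1\le j\le\zeta(n)$ and $A_j=\mathrm{M}_2(F_j)$ for $\zeta(n)+1\le j\le r+s$. Define for $u=P(a)+bQ(a)$: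 $\gamma_1(u)=P(1)+Q(1)h$; $\gamma_2(u)=P(-1)+Q(-1)h$ (for $n$ even); for $j\ge\zeta(n)+1$, $\tau_j(u)=\begin{pmatrix}P(\alpha_j)&Q(\alpha_j^{-1})\\ Q(\alpha_j)&P(\alpha_j^{-1})\end{pmatrix}$; for $\zeta(n)+1\le j\le r$, $\sigma_j(X)=Z_j^{-1}XZ_j$ with $Z_j=\begin{pmatrix}1&-\alpha_j\\ 1&-\alpha_j^{-1}\end{pmatrix}$. Put $\mathcal{P}_j=\gamma_j$ for $j\le\zeta(n)$, $\mathcal{P}_j=\sigma_j\tau_j$ for $\zeta(n)+1\le j\le r$, $\mathcal{P}_j=\tau_j$ for $r+1\le j\le r+s$. It is known that $\mathcal{P}=\bigoplus_{j=1}^{r+s}\mathcal{P}_j:\mathbb{F}_qD_n\to\bigoplus_{j=1}^{r+s}A_j$ is an algebra isomorphism. For $x,y\in F_j$ put $I_j(x,y)=\mathbb{F}_q\langle h\mid h^2\rangle\left[(x+y)+(x-y)h\right]$ for $1\le j\le\zeta(n)$, and $I_j(x,y)=\left\{\begin{pmatrix}ky & -kx \\ ty & -tx\end{pmatrix}\mid k,t\in F_j\right\}$ for $\zeta(n)+1\le j\le r+s$. *)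

theory Defs
  imports
    "HOL-Analysis.Cartesian_Space"
    "HOL-Analysis.Determinants"
    "HOL-Algebra.Elementary_Groups"
    "HOL-Algebra.Algebraic_Closure_Type"
begin

text \<open>
  The pair \<open>(e, i)\<close> encodes \<open>b\<^sup>e a\<^sup>i\<close> (\<open>True\<close> meaning exponent 1) with \<open>0 \<le> i < n\<close>; the
  product is \<open>b\<^sup>e a\<^sup>i b\<^sup>f a\<^sup>k = b\<^bsup>e+f\<^esup> a\<^bsup>(-1)^f i + k\<^esup>\<close>. Lemma \<open>dihedral_presentation\<close>
  checks that this is the group of order \<open>2n\<close> given by the usual presentation.
\<close>

definition dihedral_group :: "nat \<Rightarrow> (bool \<times> int) monoid" where
  "dihedral_group n =
     \<lparr>carrier = UNIV \<times> {0..<int n},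
      monoid.mult = (\<lambda>(e, i) (f, k). (e \<noteq> f, ((if f then - i else i) + k) mod int n)),
      one = (False, 0)\<rparr>"

text \<open>
  The group algebra of a \<^emph>\<open>finite\<close> group \<open>G\<close> over a subfield \<open>K\<close> of a field: functions from \<open>G\<close>
  to \<open>K\<close>, extended by 0 outside \<open>G\<close>, with convolution as product.
\<close>

definition group_algebra :: "'k::field set \<Rightarrow> ('g, 'm) monoid_scheme \<Rightarrow> ('g \<Rightarrow> 'k) ring" where
  "group_algebra K G =
     \<lparr>carrier = {u. (\<forall>g. u g \<in> K) \<and> (\<forall>g. g \<notin> carrier G \<longrightarrow> u g = 0)},
      monoid.mult = (\<lambda>u v g. if g \<in> carrier G
        then \<Sum>h\<in>carrier G. u h * v (inv\<^bsub>G\<^esub> h \<otimes>\<^bsub>G\<^esub> g) else 0),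
      one = (\<lambda>g. if g = \<one>\<^bsub>G\<^esub> then 1 else 0),
      ring.zero = (\<lambda>g. 0),
      add = (\<lambda>u v g. u g + v g)\<rparr>"

definition left_ideal :: "'a set \<Rightarrow> ('a, 'm) ring_scheme \<Rightarrow> bool" where
  "left_ideal I R \<longleftrightarrow>
     additive_subgroup I R \<and> (\<forall>r\<in>carrier R. \<forall>x\<in>I. r \<otimes>\<^bsub>R\<^esub> x \<in> I)"

abbreviation dihedral_algebra :: "nat \<Rightarrow> (bool \<times> int \<Rightarrow> 'a::field) ring" where
  "dihedral_algebra n \<equiv> group_algebra UNIV (dihedral_group n)"

definition dihedral_code :: "nat \<Rightarrow> (bool \<times> int \<Rightarrow> 'a::field) set \<Rightarrow> bool" where
  "dihedral_code n I \<longleftrightarrow> left_ideal I (dihedral_algebra n)"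

text \<open>The polynomials \<open>P\<close> and \<open>Q\<close> of degree less than \<open>n\<close> with \<open>u = P(a) + b Q(a)\<close>.\<close>

definition P_poly :: "nat \<Rightarrow> (bool \<times> int \<Rightarrow> 'a::field) \<Rightarrow> 'a poly" where
  "P_poly n u = (\<Sum>i<n. Polynomial.monom (u (False, int i)) i)"

definition Q_poly :: "nat \<Rightarrow> (bool \<times> int \<Rightarrow> 'a::field) \<Rightarrow> 'a poly" where
  "Q_poly n u = (\<Sum>i<n. Polynomial.monom (u (True, int i)) i)"

definition zeta :: "nat \<Rightarrow> nat" where
  "zeta n = (if odd n then 1 else 2)"

text \<open>The reciprocal polynomial \<open>g\<^sup>*\<close> is \<^const>\<open>reflect_poly\<close>; here it is scaled to be monic.\<close>

definition monic_reciprocal :: "'a::field poly \<Rightarrow> 'a poly" where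
  "monic_reciprocal g =
     smult (inverse (lead_coeff (reflect_poly g))) (reflect_poly g)"

abbreviation eval_ac :: "'a::field poly \<Rightarrow> 'a alg_closure \<Rightarrow> 'a alg_closure" where
  "eval_ac p z \<equiv> poly (map_poly to_ac p) z"

definition dihedral_factorization ::
    "nat \<Rightarrow> nat \<Rightarrow> nat \<Rightarrow> (nat \<Rightarrow> 'a::field poly) \<Rightarrow> bool" where
  "dihedral_factorization n r s f \<longleftrightarrow>
     Polynomial.monom 1 n - 1
       = (\<Prod>j\<in>{1..r}. f j) * (\<Prod>j\<in>{r+1..r+s}. f j * monic_reciprocal (f j)) \<and>
     (\<forall>j\<in>{1..r+s}. Factorial_Ring.irreducible (f j) \<and> lead_coeff (f j) = 1) \<and>
     (\<forall>j\<in>{r+1..r+s}. Factorial_Ring.irreducible (monic_reciprocal (f j))) \<and>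
     inj_on f {1..r+s} \<and>
     inj_on (\<lambda>j. monic_reciprocal (f j)) {r+1..r+s} \<and>
     f ` {1..r+s} \<inter> (\<lambda>j. monic_reciprocal (f j)) ` {r+1..r+s} = {} \<and>
     zeta n \<le> r \<and> f 1 = [:-1, 1:] \<and> (even n \<longrightarrow> f 2 = [:1, 1:]) \<and>
     (\<forall>j\<in>{2..r}. reflect_poly (f j) = f j) \<and>
     (\<forall>j\<in>{r+1..r+s}. \<nexists>z. eval_ac (f j) z = 0 \<and> eval_ac (reflect_poly (f j)) z = 0)"

text \<open>All the fields \<open>F\<^sub>j\<close> live inside one algebraic closure, in which the base field is
  \<^term>\<open>range to_ac\<close>.\<close>

definition adjoin :: "'a::field alg_closure \<Rightarrow> 'a alg_closure set" where
  "adjoin z = range (\<lambda>p. eval_ac p z)"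

definition F_field ::
    "nat \<Rightarrow> nat \<Rightarrow> (nat \<Rightarrow> 'a::field alg_closure) \<Rightarrow> nat \<Rightarrow> 'a alg_closure set" where
  "F_field n r \<alpha> j =
     (if j \<le> zeta n then range to_ac
      else if j \<le> r then adjoin (\<alpha> j + inverse (\<alpha> j))
      else adjoin (\<alpha> j))"

text \<open>
  The group algebra of \<open>\<langle>h | h\<^sup>2\<rangle>\<close> is taken over \<^term>\<open>integer_mod_group 2\<close>, with \<open>h\<close> the
  residue class 1; \<open>cyc x y\<close> is \<open>x + y h\<close>.
\<close>

abbreviation C2_algebra :: "(int \<Rightarrow> 'a::field alg_closure) ring" where
  "C2_algebra \<equiv> group_algebra (range to_ac) (integer_mod_group 2)"

definition cyc :: "'k::zero \<Rightarrow> 'k \<Rightarrow> int \<Rightarrow> 'k" where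
  "cyc x y = (\<lambda>g. if g = 0 then x else if g = 1 then y else 0)"

definition mat2 :: "'k::zero \<Rightarrow> 'k \<Rightarrow> 'k \<Rightarrow> 'k \<Rightarrow> 'k^2^2" where
  "mat2 a b c d = vector [vector [a, b], vector [c, d]]"

text \<open>The summands \<open>A\<^sub>j\<close> are of two kinds, so they are put into a sum type.\<close>

type_synonym 'k component = "(int \<Rightarrow> 'k) + 'k^2^2"

definition A_comp ::
    "nat \<Rightarrow> nat \<Rightarrow> (nat \<Rightarrow> 'a::field alg_closure) \<Rightarrow> nat \<Rightarrow> 'a alg_closure component set" where
  "A_comp n r \<alpha> j =
     (if j \<le> zeta n then Inl ` carrier C2_algebra
      else Inr ` {M. \<forall>i k. M $ i $ k \<in> F_field n r \<alpha> j})"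

definition zero_comp :: "nat \<Rightarrow> nat \<Rightarrow> 'k::field component set" where
  "zero_comp n j = (if j \<le> zeta n then {Inl (\<lambda>g. 0)} else {Inr 0})"

definition I_comp ::
    "nat \<Rightarrow> nat \<Rightarrow> (nat \<Rightarrow> 'a::field alg_closure) \<Rightarrow> nat
      \<Rightarrow> 'a alg_closure \<Rightarrow> 'a alg_closure \<Rightarrow> 'a alg_closure component set" where
  "I_comp n r \<alpha> j x y =
     (if j \<le> zeta n
      then Inl ` {c \<otimes>\<^bsub>C2_algebra\<^esub> cyc (x + y) (x - y) | c. c \<in> carrier C2_algebra}
      else Inr ` {mat2 (k * y) (- k * x) (t * y) (- t * x) | k t.
                    k \<in> F_field n r \<alpha> j \<and> t \<in> F_field n r \<alpha> j})"

definition gamma :: "nat \<Rightarrow> nat \<Rightarrow> (bool \<times> int \<Rightarrow> 'a::field) \<Rightarrow> int \<Rightarrow> 'a alg_closure" where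
  "gamma n j u =
     (let c = (if j = 1 then 1 else - 1)
      in cyc (to_ac (poly (P_poly n u) c)) (to_ac (poly (Q_poly n u) c)))"

definition tau ::
    "nat \<Rightarrow> 'a::field alg_closure \<Rightarrow> (bool \<times> int \<Rightarrow> 'a) \<Rightarrow> 'a alg_closure^2^2" where
  "tau n z u =
     mat2 (eval_ac (P_poly n u) z) (eval_ac (Q_poly n u) (inverse z))
          (eval_ac (Q_poly n u) z) (eval_ac (P_poly n u) (inverse z))"

definition sigma :: "'k::field \<Rightarrow> 'k^2^2 \<Rightarrow> 'k^2^2" where
  "sigma z M =
     (let Z = mat2 1 (- z) 1 (- inverse z) in matrix_inv Z ** M ** Z)"

definition P_map ::
    "nat \<Rightarrow> nat \<Rightarrow> nat \<Rightarrow> (nat \<Rightarrow> 'a::field alg_closure)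
      \<Rightarrow> (bool \<times> int \<Rightarrow> 'a) \<Rightarrow> nat \<Rightarrow> 'a alg_closure component" where
  "P_map n r s \<alpha> u =
     (\<lambda>j\<in>{1..r+s}. if j \<le> zeta n then Inl (gamma n j u)
                   else if j \<le> r then Inr (sigma (\<alpha> j) (tau n (\<alpha> j) u))
                   else Inr (tau n (\<alpha> j) u))"

lemma group_dihedral_group: "0 < n \<Longrightarrow> group (dihedral_group n)"
proof (rule groupI)
  fix x y z assume "0 < n" and "x \<in> carrier (dihedral_group n)"
    "y \<in> carrier (dihedral_group n)" "z \<in> carrier (dihedral_group n)"
  obtain e i f k g l where [simp]: "x = (e, i)" "y = (f, k)" "z = (g, l)"
    by (cases x, cases y, cases z)
  show "x \<otimes>\<^bsub>dihedral_group n\<^esub> y \<otimes>\<^bsub>dihedral_group n\<^esub> z =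
        x \<otimes>\<^bsub>dihedral_group n\<^esub> (y \<otimes>\<^bsub>dihedral_group n\<^esub> z)"
    by (auto simp: dihedral_group_def mod_simps algebra_simps)
next
  fix x assume n: "0 < n" and "x \<in> carrier (dihedral_group n)"
  then obtain e i where x: "x = (e, i)" "0 \<le> i" "i < int n"
    by (auto simp: dihedral_group_def)
  show "\<exists>y\<in>carrier (dihedral_group n). y \<otimes>\<^bsub>dihedral_group n\<^esub> x = \<one>\<^bsub>dihedral_group n\<^esub>"
    using n x by (intro bexI[of _ "(e, if e then i else (- i) mod int n)"])
                 (auto simp: dihedral_group_def mod_simps)
qed (auto simp: dihedral_group_def)

lemma dihedral_presentation:
  assumes "0 < n"
  defines "G \<equiv> dihedral_group n" and "a \<equiv> (False, 1 mod int n)" and "b \<equiv> (True, 0)"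
  shows "a \<in> carrier G" "b \<in> carrier G" "Coset.order G = 2 * n"
    "a [^]\<^bsub>G\<^esub> n = \<one>\<^bsub>G\<^esub>" "b [^]\<^bsub>G\<^esub> (2::nat) = \<one>\<^bsub>G\<^esub>" "b \<otimes>\<^bsub>G\<^esub> a \<otimes>\<^bsub>G\<^esub> b = inv\<^bsub>G\<^esub> a"
    and "i < n \<Longrightarrow> a [^]\<^bsub>G\<^esub> i = (False, int i)"
    and "i < n \<Longrightarrow> b \<otimes>\<^bsub>G\<^esub> a [^]\<^bsub>G\<^esub> i = (True, int i)"
proof -
  interpret group G unfolding G_def using group_dihedral_group[OF assms(1)] .
  show a: "a \<in> carrier G" and b: "b \<in> carrier G"
    using assms(1) by (auto simp: G_def a_def b_def dihedral_group_def)
  show "Coset.order G = 2 * n"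
    by (simp add: Coset.order_def G_def dihedral_group_def card_cartesian_product)
  have pow: "a [^]\<^bsub>G\<^esub> i = (False, int i mod int n)" for i :: nat
  proof (induction i)
    case 0
    show ?case by (simp add: G_def dihedral_group_def)
  next
    case (Suc i)
    then show ?case
      by (simp add: G_def a_def dihedral_group_def mod_simps add.commute)
  qed
  show "a [^]\<^bsub>G\<^esub> n = \<one>\<^bsub>G\<^esub>" by (simp add: pow) (simp add: G_def dihedral_group_def)
  show "b [^]\<^bsub>G\<^esub> (2::nat) = \<one>\<^bsub>G\<^esub>"
    by (simp add: numeral_2_eq_2) (simp add: G_def b_def dihedral_group_def)
  have "b \<otimes>\<^bsub>G\<^esub> a \<otimes>\<^bsub>G\<^esub> b \<otimes>\<^bsub>G\<^esub> a = \<one>\<^bsub>G\<^esub>"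
    by (simp add: G_def a_def b_def dihedral_group_def mod_simps)
  then show "b \<otimes>\<^bsub>G\<^esub> a \<otimes>\<^bsub>G\<^esub> b = inv\<^bsub>G\<^esub> a"
    using a b by (metis inv_equality m_closed)
  show "a [^]\<^bsub>G\<^esub> i = (False, int i)" if "i < n"
    using that by (simp add: pow)
  show "b \<otimes>\<^bsub>G\<^esub> a [^]\<^bsub>G\<^esub> i = (True, int i)" if "i < n"
    using that by (simp add: pow) (simp add: G_def b_def dihedral_group_def)
qed

end

theory Submission
  imports Defs
begin

text \<open>
  The group algebra of \<open>D\<^sub>n\<close> is a direct sum of the algebras \<open>A\<^sub>j\<close>, and a left ideal of a direct sum
  of rings with unit is the direct sum of its projections. The theorem follows once the projections
  are known to be left ideals of the \<open>A\<^sub>j\<close> and these are classified.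

  Each projection \<open>u \<mapsto> \<P>\<^sub>j(u)\<close> is a ring homomorphism, as the multiplication in \<open>D\<^sub>n\<close>
  translates into a formula for the values of \<open>P\<close> and \<open>Q\<close> at \<open>z\<close> and \<open>z\<^bsup>-1\<^esup>\<close> for an \<open>n\<close>-th root of
  unity \<open>z\<close> (\<open>coset_eval_mult\<close>). It maps into \<open>A\<^sub>j\<close> (\<open>component_in_A\<close>) and onto \<open>A\<^sub>j\<close>
  (\<open>component_surj\<close>): every matrix over \<open>F\<^sub>j\<close> is a combination of images of \<open>1\<close>, \<open>a\<close>, \<open>b\<close>, \<open>a b\<close> with
  coefficients that are polynomials in \<open>a + a\<^bsup>-1\<^esup>\<close>, or, for a factor that is not self-reciprocal, its
  entries are prescribed independently by interpolation. By the Chinese remainder theorem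
  (\<open>crt_idempotent\<close>) there are elements \<open>e\<^sub>j\<close> that act as the identity on component \<open>j\<close> and as zero on
  all the others (\<open>component_projector\<close>). Hence the image of a code \<open>I\<close> is the full product of its
  projections (\<open>P_map_image_code\<close>), and surjectivity makes each projection a left ideal of \<open>A\<^sub>j\<close>
  (\<open>code_component_left_ideal\<close>).

  Left ideals of both kinds of \<open>A\<^sub>j\<close> come from subspaces \<open>W\<close> of the plane \<open>F\<^sub>j\<^sup>2\<close>: for matrices \<open>W\<close> is the
  space of rows, and for \<open>\<langle>h | h\<^sup>2\<rangle>\<close> it is the ideal itself, which is stable under exchanging the two
  coordinates. The possibilities zero, everything, vertical line, line with a slope
  (\<open>plane_subspace_cases\<close>) are those of the theorem; stability under the exchange leaves only the
  slopes \<open>1\<close> and \<open>-1\<close>, which coincide in characteristic 2.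

  Conversely, each \<open>I\<^sub>j(x, y)\<close> is a left ideal of \<open>A\<^sub>j\<close> (\<open>comp_left_ideal_I\<close>), and preimages of left
  ideals under a homomorphism are left ideals.
\<close>

section \<open>Evaluating polynomials in the algebraic closure\<close>

lemma eval_ac_pCons: "eval_ac (pCons a p) z = to_ac a + z * eval_ac p z"
  by (simp add: map_poly_pCons)

lemma eval_ac_add: "eval_ac (p + q) z = eval_ac p z + eval_ac q z"
  by (induction p q rule: poly_induct2) (simp_all add: eval_ac_pCons algebra_simps)

lemma eval_ac_smult: "eval_ac (smult c p) z = to_ac c * eval_ac p z"
  by (simp add: map_poly_smult)

lemma eval_ac_mult: "eval_ac (p * q) z = eval_ac p z * eval_ac q z"
  by (induction p) (simp_all add: eval_ac_pCons eval_ac_add eval_ac_smult algebra_simps)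

lemma eval_ac_minus: "eval_ac (- p) z = - eval_ac p z"
  using eval_ac_smult[of "-1" p z] by simp

lemma eval_ac_diff: "eval_ac (p - q) z = eval_ac p z - eval_ac q z"
  using eval_ac_add[of p "- q" z] by (simp add: eval_ac_minus)

lemma eval_ac_monom: "eval_ac (Polynomial.monom c k) z = to_ac c * z ^ k"
  by (simp add: map_poly_monom poly_monom)

lemma eval_ac_sum: "eval_ac (\<Sum>i\<in>A. p i) z = (\<Sum>i\<in>A. eval_ac (p i) z)"
  by (induction A rule: infinite_finite_induct) (simp_all add: eval_ac_add)

lemma eval_ac_pcompose: "eval_ac (pcompose p q) z = eval_ac p (eval_ac q z)"
  by (induction p) (simp_all add: pcompose_pCons eval_ac_pCons eval_ac_add eval_ac_mult)

lemma eval_ac_to_ac: "eval_ac p (to_ac c) = to_ac (poly p c)"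
  by (induction p) (simp_all add: eval_ac_pCons)

text \<open>
  This is what turns a statement about the reciprocal polynomial of \<open>f\<^sub>j\<close> into one about \<open>\<alpha>\<^sub>j\<^bsup>-1\<^esup>\<close>.
\<close>

lemma eval_ac_reflect_poly:
  assumes "z \<noteq> 0"
  shows "eval_ac (reflect_poly p) z = z ^ degree p * eval_ac p (inverse z)"
proof -
  have deg: "degree (map_poly to_ac p) = degree p"
    by (rule degree_map_poly) simp
  have "map_poly to_ac (reflect_poly p) = reflect_poly (map_poly to_ac p)"
    by (rule poly_eqI) (simp add: coeff_reflect_poly coeff_map_poly deg)
  then show ?thesis
    using assms by (simp add: poly_reflect_poly_nz deg)
qed

lemmas eval_ac_simps = eval_ac_pCons eval_ac_add eval_ac_smult eval_ac_mult eval_ac_minus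
  eval_ac_diff eval_ac_monom eval_ac_pcompose

section \<open>Subfields of the algebraic closure\<close>

text \<open>
  The fields \<open>F\<^sub>j\<close> are sets of elements of one field type, so a bare closure predicate lets the
  arguments of linear algebra below use the ambient field operations directly.
\<close>

definition is_subfield :: "'k::field set \<Rightarrow> bool" where
  "is_subfield F \<longleftrightarrow> 0 \<in> F \<and> 1 \<in> F \<and> (\<forall>x\<in>F. \<forall>y\<in>F. x + y \<in> F \<and> x * y \<in> F) \<and>
     (\<forall>x\<in>F. - x \<in> F \<and> inverse x \<in> F)"

lemma is_subfieldD:
  assumes "is_subfield F"
  shows "0 \<in> F" "1 \<in> F" "x \<in> F \<Longrightarrow> y \<in> F \<Longrightarrow> x + y \<in> F" "x \<in> F \<Longrightarrow> y \<in> F \<Longrightarrow> x * y \<in> F"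
    "x \<in> F \<Longrightarrow> - x \<in> F" "x \<in> F \<Longrightarrow> inverse x \<in> F" "x \<in> F \<Longrightarrow> y \<in> F \<Longrightarrow> x - y \<in> F"
    "x \<in> F \<Longrightarrow> y \<in> F \<Longrightarrow> x / y \<in> F"
proof -
  show *: "0 \<in> F" "1 \<in> F" "x \<in> F \<Longrightarrow> y \<in> F \<Longrightarrow> x + y \<in> F" "x \<in> F \<Longrightarrow> y \<in> F \<Longrightarrow> x * y \<in> F"
    "x \<in> F \<Longrightarrow> - x \<in> F" "x \<in> F \<Longrightarrow> inverse x \<in> F" for x y
    using assms by (auto simp: is_subfield_def)
  show "x \<in> F \<Longrightarrow> y \<in> F \<Longrightarrow> x - y \<in> F" "x \<in> F \<Longrightarrow> y \<in> F \<Longrightarrow> x / y \<in> F"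
    using *(3)[of x "- y"] *(4)[of x "inverse y"] *(5,6)[of y] by (auto simp: divide_inverse)
qed

lemma is_subfield_range_to_ac: "is_subfield (range to_ac)"
proof -
  have "to_ac x + to_ac y \<in> range to_ac" "to_ac x * to_ac y \<in> range to_ac"
    "- to_ac x \<in> range to_ac" "inverse (to_ac x) \<in> range to_ac" for x y :: 'a
    by (metis rangeI to_ac_add to_ac_mult to_ac_minus to_ac_inverse)+
  moreover have "0 \<in> range to_ac" "1 \<in> range to_ac"
    by (metis rangeI to_ac_0 to_ac_1)+
  ultimately show ?thesis unfolding is_subfield_def by blast
qed

lemma adjoinI: "eval_ac p z \<in> adjoin z"
  by (auto simp: adjoin_def)

text \<open>
  If \<open>c + w p(w) = 0\<close> with \<open>c \<noteq> 0\<close>, then \<open>- p(w) / c\<close> inverts \<open>w\<close>; a vanishing constant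
  coefficient can be divided away because \<open>w \<noteq> 0\<close>. Hence polynomial expressions in an algebraic
  element form a field, not just a ring. For \<open>w = 0\<close> the convention \<open>inverse 0 = 0\<close> applies.
\<close>

lemma inverse_in_adjoin_self:
  fixes w :: "'a::field alg_closure"
  shows "inverse w \<in> adjoin w"
proof -
  obtain p :: "'a poly" where p: "p \<noteq> 0" "eval_ac p w = 0"
    using alg_closure_algebraic .
  then show ?thesis
  proof (induction p)
    case (pCons c p)
    have eq: "to_ac c + w * eval_ac p w = 0"
      using pCons.prems by (simp add: eval_ac_pCons)
    show ?case
    proof (cases "w = 0 \<or> c = 0")
      case True
      then consider "w = 0" | "w \<noteq> 0" "c = 0" by blast
      then show ?thesis
      proof cases
        case 1
        then show ?thesis using adjoinI[of 0 w] by simp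
      next
        case 2
        then show ?thesis using pCons eq by (cases "p = 0") auto
      qed
    next
      case False
      have "w * eval_ac p w = - to_ac c"
        using eq by (simp add: eq_neg_iff_add_eq_0 add.commute)
      then have "w * eval_ac (smult (- inverse c) p) w = 1"
        using False by (simp add: eval_ac_smult eval_ac_minus mult.left_commute[of w])
      then have "inverse w = eval_ac (smult (- inverse c) p) w"
        by (rule inverse_unique)
      then show ?thesis by (simp only: adjoinI)
    qed
  qed auto
qed

lemma is_subfield_adjoin: "is_subfield (adjoin z)"
proof -
  have add: "eval_ac p z + eval_ac q z \<in> adjoin z" for p q
    using adjoinI[of "p + q" z] by (simp add: eval_ac_add)
  have mult: "eval_ac p z * eval_ac q z \<in> adjoin z" for p q
    using adjoinI[of "p * q" z] by (simp add: eval_ac_mult)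
  have minus: "- eval_ac p z \<in> adjoin z" for p
    using adjoinI[of "- p" z] by (simp add: eval_ac_minus)
  have inv: "inverse (eval_ac p z) \<in> adjoin z" for p
  proof -
    obtain q where "inverse (eval_ac p z) = eval_ac q (eval_ac p z)"
      using inverse_in_adjoin_self[of "eval_ac p z"] by (auto simp: adjoin_def)
    then show ?thesis
      using adjoinI[of "pcompose q p" z] by (simp add: eval_ac_pcompose)
  qed
  have "0 \<in> adjoin z" "1 \<in> adjoin z"
    using adjoinI[of 0 z] adjoinI[of 1 z] by simp_all
  then show ?thesis
    using add mult minus inv unfolding is_subfield_def by (auto simp: adjoin_def)
qed

lemma F_field_is_subfield: "is_subfield (F_field n r \<alpha> j)"
  by (simp add: F_field_def is_subfield_range_to_ac is_subfield_adjoin)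

section \<open>Idempotent polynomials modulo distinct irreducible factors\<close>

text \<open>
  A nonzero element \<open>d\<close> of least degree in the ideal generated by \<open>p\<close> and \<open>q\<close> divides both, by
  division with remainder. As \<open>p\<close> is irreducible, \<open>d\<close> is a unit or an associate of \<open>p\<close>, and the
  latter would give \<open>p dvd q\<close>.
\<close>

lemma irreducible_imp_bezout:
  fixes p q :: "'a::field poly"
  assumes "Factorial_Ring.irreducible p" "\<not> p dvd q"
  obtains a b where "a * p + b * q = 1"
proof -
  define I where "I = {d. d \<noteq> 0 \<and> (\<exists>a b. d = a * p + b * q)}"
  have p0: "p \<noteq> 0" using assms(1) by auto
  have "p = 1 * p + 0 * q" by simp
  then have "p \<in> I" unfolding I_def using p0 by blast
  then obtain d where d: "d \<in> I" and min: "\<And>e. e \<in> I \<Longrightarrow> degree d \<le> degree e"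
    using ex_has_least_nat[of "\<lambda>d. d \<in> I" p degree] by blast
  obtain a b where ab: "d = a * p + b * q" and d0: "d \<noteq> 0" using d by (auto simp: I_def)
  have dvd: "d dvd x * p + y * q" for x y
  proof (rule ccontr)
    let ?m = "(x * p + y * q) mod d"
    assume "\<not> d dvd x * p + y * q"
    then have m0: "?m \<noteq> 0" by (simp add: mod_eq_0_iff_dvd)
    have "?m = (x * p + y * q) - (x * p + y * q) div d * d"
      by (simp add: minus_div_mult_eq_mod)
    also have "\<dots> = (x - (x * p + y * q) div d * a) * p + (y - (x * p + y * q) div d * b) * q"
      unfolding ab by (simp add: algebra_simps)
    finally have "?m \<in> I" using m0 unfolding I_def by blast
    then have "degree d \<le> degree ?m" by (rule min)
    moreover have "degree ?m < degree d \<or> ?m = 0" using d0 degree_mod_less[of d] by auto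
    ultimately show False using m0 by simp
  qed
  have "d dvd p" "d dvd q" using dvd[of 1 0] dvd[of 0 1] by simp_all
  have "is_unit d"
  proof (rule ccontr)
    assume nu: "\<not> is_unit d"
    obtain c where c: "p = d * c" using \<open>d dvd p\<close> by blast
    then have "is_unit c" using irreducibleD[OF assms(1) c] nu by blast
    then have "p dvd d" unfolding c by (simp add: mult_unit_dvd_iff)
    then show False using \<open>d dvd q\<close> assms(2) dvd_trans by blast
  qed
  then obtain e where "1 = d * e" by blast
  then have "(e * a) * p + (e * b) * q = 1" unfolding ab by (simp add: algebra_simps)
  then show ?thesis by (rule that)
qed

text \<open>
  For each \<open>q\<close> in \<open>S\<close> a Bezout identity \<open>a p + b q = 1\<close> supplies the polynomial \<open>b q\<close>, which is
  1 at the roots of \<open>p\<close> and 0 at those of \<open>q\<close>; the product over \<open>S\<close> has all the required values.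
\<close>

lemma crt_idempotent_single:
  fixes S :: "'a::field poly set"
  assumes "finite S" "Factorial_Ring.irreducible p"
    and "\<And>q. q \<in> S \<Longrightarrow> \<not> p dvd q"
  obtains e where "\<And>z. eval_ac p z = 0 \<Longrightarrow> eval_ac e z = 1"
    "\<And>q z. q \<in> S \<Longrightarrow> eval_ac q z = 0 \<Longrightarrow> eval_ac e z = 0"
proof -
  have "\<exists>e. (\<forall>z. eval_ac p z = 0 \<longrightarrow> eval_ac e z = 1) \<and>
    (\<forall>q\<in>S. \<forall>z. eval_ac q z = 0 \<longrightarrow> eval_ac e z = 0)"
    using assms(1,3)
  proof (induction S)
    case empty
    then show ?case by (intro exI[of _ 1]) simp
  next
    case (insert q S)
    then obtain e where e: "\<forall>z. eval_ac p z = 0 \<longrightarrow> eval_ac e z = 1"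
      "\<forall>q\<in>S. \<forall>z. eval_ac q z = 0 \<longrightarrow> eval_ac e z = 0" by blast
    obtain a b where ab: "a * p + b * q = 1"
      using irreducible_imp_bezout[OF assms(2), of q] insert.prems by blast
    have "eval_ac (b * q) z = 1" if "eval_ac p z = 0" for z
      using arg_cong[OF ab, of "\<lambda>t. eval_ac t z"] that by (simp add: eval_ac_simps)
    then show ?case using e
      by (intro exI[of _ "b * q * e"]) (auto simp: eval_ac_mult)
  qed
  then show ?thesis using that by blast
qed

lemma monic_irreducible_dvd_imp_eq:
  fixes p q :: "'a::field poly"
  assumes "Factorial_Ring.irreducible p" "Factorial_Ring.irreducible q"
    "lead_coeff p = 1" "lead_coeff q = 1" "p dvd q"
  shows "p = q"
proof -
  obtain c where c: "q = p * c" using assms(5) by blast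
  then have "is_unit c"
    using irreducibleD[OF assms(2) c] assms(1) by (auto simp: irreducible_def)
  then obtain k where k: "c = [:k:]" by (auto simp: is_unit_poly_iff)
  have "lead_coeff q = lead_coeff p * k" unfolding c k by (simp only: lead_coeff_mult) simp
  then have "k = 1" using assms(3,4) by simp
  then show ?thesis using c k by (simp add: one_pCons)
qed

text \<open>
  Distinct monic irreducible polynomials do not divide each other, so every member of \<open>T\<close> has its
  own idempotent, and these can be added. This is the Chinese remainder theorem in terms of values
  at roots.
\<close>

lemma crt_idempotent:
  fixes S T :: "'a::field poly set"
  assumes "finite S" "T \<subseteq> S"
    and "\<And>p. p \<in> S \<Longrightarrow> Factorial_Ring.irreducible p \<and> lead_coeff p = 1"
  obtains e where "\<And>q z. q \<in> T \<Longrightarrow> eval_ac q z = 0 \<Longrightarrow> eval_ac e z = 1"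
    "\<And>q z. q \<in> S - T \<Longrightarrow> eval_ac q z = 0 \<Longrightarrow> eval_ac e z = 0"
proof -
  have "\<exists>e. \<forall>z. (eval_ac p z = 0 \<longrightarrow> eval_ac e z = 1) \<and>
      (\<forall>q\<in>S - {p}. eval_ac q z = 0 \<longrightarrow> eval_ac e z = 0)" if "p \<in> S" for p
  proof -
    have "\<not> p dvd q" if "q \<in> S - {p}" for q
      using monic_irreducible_dvd_imp_eq[of p q] assms(3) that \<open>p \<in> S\<close> by auto
    then show ?thesis
      using crt_idempotent_single[of "S - {p}" p] assms(1,3) \<open>p \<in> S\<close>
      by (metis finite_Diff)
  qed
  then obtain e where e: "\<And>p z. p \<in> S \<Longrightarrow> eval_ac p z = 0 \<Longrightarrow> eval_ac (e p) z = 1"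
    "\<And>p q z. p \<in> S \<Longrightarrow> q \<in> S - {p} \<Longrightarrow> eval_ac q z = 0 \<Longrightarrow> eval_ac (e p) z = 0"
    by metis
  have fin: "finite T" using assms(1,2) finite_subset by blast
  show ?thesis
  proof (rule that[of "\<Sum>p\<in>T. e p"])
    fix q z assume q: "q \<in> T" "eval_ac q z = 0"
    have "eval_ac (\<Sum>p\<in>T. e p) z = eval_ac (e q) z + (\<Sum>p\<in>T - {q}. eval_ac (e p) z)"
      unfolding eval_ac_sum using fin q(1) by (rule sum.remove)
    also have "(\<Sum>p\<in>T - {q}. eval_ac (e p) z) = 0"
      using e(2) q assms(2) by (intro sum.neutral) blast
    finally show "eval_ac (\<Sum>p\<in>T. e p) z = 1" using e(1) q assms(2) by auto
  next
    fix q z assume q: "q \<in> S - T" "eval_ac q z = 0"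
    then show "eval_ac (\<Sum>p\<in>T. e p) z = 0"
      unfolding eval_ac_sum using e(2) assms(2) by (intro sum.neutral) blast
  qed
qed

section \<open>Group algebras\<close>

lemma group_algebra_carrier_iff:
  "u \<in> carrier (group_algebra UNIV G) \<longleftrightarrow> (\<forall>g. g \<notin> carrier G \<longrightarrow> u g = 0)"
  by (simp add: group_algebra_def)

lemma group_algebra_add: "u \<oplus>\<^bsub>group_algebra K G\<^esub> v = (\<lambda>g. u g + v g)"
  by (simp add: group_algebra_def)

lemma group_algebra_zero: "\<zero>\<^bsub>group_algebra K G\<^esub> = (\<lambda>g. 0)"
  by (simp add: group_algebra_def)

lemma group_algebra_mult:
  "u \<otimes>\<^bsub>group_algebra K G\<^esub> v =
    (\<lambda>g. if g \<in> carrier G then \<Sum>h\<in>carrier G. u h * v (inv\<^bsub>G\<^esub> h \<otimes>\<^bsub>G\<^esub> g) else 0)"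
  by (simp add: group_algebra_def)

lemma group_algebra_mult_closed:
  "u \<otimes>\<^bsub>group_algebra UNIV G\<^esub> v \<in> carrier (group_algebra UNIV G)"
  by (simp add: group_algebra_carrier_iff group_algebra_mult)

lemma group_algebra_additive_group: "group (add_monoid (group_algebra UNIV G))"
proof (rule groupI)
  fix x assume "x \<in> carrier (add_monoid (group_algebra UNIV G))"
  then show "\<exists>y\<in>carrier (add_monoid (group_algebra UNIV G)).
      y \<otimes>\<^bsub>add_monoid (group_algebra UNIV G)\<^esub> x = \<one>\<^bsub>add_monoid (group_algebra UNIV G)\<^esub>"
    by (intro bexI[of _ "\<lambda>g. - x g"]) (auto simp: group_algebra_def)
qed (auto simp: group_algebra_def add.assoc)

text \<open>
  Additive inverses come for free, because \<open>- u\<close> is the product of \<open>u\<close> with the scalar \<open>- 1\<close>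
  of the group algebra.
\<close>

lemma left_ideal_group_algebra_iff:
  fixes I :: "('g \<Rightarrow> 'k::field) set"
  assumes "group G" "finite (carrier G)"
  shows "left_ideal I (group_algebra UNIV G) \<longleftrightarrow>
    I \<subseteq> carrier (group_algebra UNIV G) \<and> (\<lambda>g. 0) \<in> I \<and>
    (\<forall>u\<in>I. \<forall>v\<in>I. u \<oplus>\<^bsub>group_algebra UNIV G\<^esub> v \<in> I) \<and>
    (\<forall>u\<in>carrier (group_algebra UNIV G). \<forall>v\<in>I. u \<otimes>\<^bsub>group_algebra UNIV G\<^esub> v \<in> I)"
    (is "?L \<longleftrightarrow> ?R")
proof
  assume ?L
  then have sub: "subgroup I (add_monoid (group_algebra UNIV G))"
    and mult: "\<forall>u\<in>carrier (group_algebra UNIV G). \<forall>v\<in>I. u \<otimes>\<^bsub>group_algebra UNIV G\<^esub> v \<in> I"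
    by (auto simp: left_ideal_def additive_subgroup_def)
  show ?R
    using subgroup.subset[OF sub] subgroup.one_closed[OF sub] subgroup.m_closed[OF sub] mult
    by (simp add: group_algebra_zero)
next
  assume R: ?R
  interpret G: group G by fact
  interpret A: group "add_monoid (group_algebra UNIV G) :: ('g \<Rightarrow> 'k) monoid"
    by (rule group_algebra_additive_group)
  have "subgroup I (add_monoid (group_algebra UNIV G))"
  proof (rule A.subgroupI)
    fix u assume u: "u \<in> I"
    let ?m = "\<lambda>g. if g = \<one>\<^bsub>G\<^esub> then - 1 else 0 :: 'k"
    have c: "u \<in> carrier (group_algebra UNIV G)" using R u by blast
    have neg: "(\<lambda>g. - u g) = ?m \<otimes>\<^bsub>group_algebra UNIV G\<^esub> u"
    proof
      fix g
      have "(\<Sum>h\<in>carrier G. ?m h * u (inv\<^bsub>G\<^esub> h \<otimes>\<^bsub>G\<^esub> g)) =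
        (\<Sum>h\<in>carrier G. if h = \<one>\<^bsub>G\<^esub> then - u (inv\<^bsub>G\<^esub> h \<otimes>\<^bsub>G\<^esub> g) else 0)"
        by (intro sum.cong) auto
      also have "\<dots> = - u (\<one>\<^bsub>G\<^esub> \<otimes>\<^bsub>G\<^esub> g)"
        using assms(2) by (simp add: sum.delta)
      finally show "- u g = (?m \<otimes>\<^bsub>group_algebra UNIV G\<^esub> u) g"
        using c by (simp add: group_algebra_mult group_algebra_carrier_iff)
    qed
    have "?m \<in> carrier (group_algebra UNIV G)"
      by (auto simp: group_algebra_carrier_iff)
    then have "(\<lambda>g. - u g) \<in> I" using R u unfolding neg by blast
    moreover have "inv\<^bsub>add_monoid (group_algebra UNIV G)\<^esub> u = (\<lambda>g. - u g)"
      using c by (intro A.inv_equality) (auto simp: group_algebra_def)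
    ultimately show "inv\<^bsub>add_monoid (group_algebra UNIV G)\<^esub> u \<in> I" by simp
  qed (use R in auto)
  then show ?L using R by (simp add: left_ideal_def additive_subgroup_def)
qed

text \<open>
  Extending a function \<open>\<phi>\<close> linearly from \<open>G\<close> to the group algebra, its value on a product is
  obtained from its values on the products of group elements. With a matrix coefficient of a
  representation for \<open>\<phi>\<close> this is the multiplicativity of the representation on the algebra.
\<close>

lemma sum_convolution:
  fixes u v :: "'g \<Rightarrow> 'k::field" and \<phi> :: "'g \<Rightarrow> 'k alg_closure"
  assumes "group G" "finite (carrier G)"
  shows "(\<Sum>g\<in>carrier G. to_ac ((u \<otimes>\<^bsub>group_algebra UNIV G\<^esub> v) g) * \<phi> g) =
    (\<Sum>h\<in>carrier G. \<Sum>k\<in>carrier G. to_ac (u h) * to_ac (v k) * \<phi> (h \<otimes>\<^bsub>G\<^esub> k))"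
proof -
  interpret group G by fact
  have "(\<Sum>g\<in>carrier G. to_ac ((u \<otimes>\<^bsub>group_algebra UNIV G\<^esub> v) g) * \<phi> g) =
    (\<Sum>g\<in>carrier G. \<Sum>h\<in>carrier G. to_ac (u h) * to_ac (v (inv\<^bsub>G\<^esub> h \<otimes>\<^bsub>G\<^esub> g)) * \<phi> g)"
    by (simp add: group_algebra_mult to_ac_sum sum_distrib_right)
  also have "\<dots> = (\<Sum>h\<in>carrier G. \<Sum>g\<in>carrier G.
      to_ac (u h) * to_ac (v (inv\<^bsub>G\<^esub> h \<otimes>\<^bsub>G\<^esub> g)) * \<phi> g)"
    by (rule sum.swap)
  also have "\<dots> = (\<Sum>h\<in>carrier G. \<Sum>k\<in>carrier G. to_ac (u h) * to_ac (v k) * \<phi> (h \<otimes>\<^bsub>G\<^esub> k))"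
  proof (rule sum.cong[OF refl])
    fix h assume h: "h \<in> carrier G"
    show "(\<Sum>g\<in>carrier G. to_ac (u h) * to_ac (v (inv\<^bsub>G\<^esub> h \<otimes>\<^bsub>G\<^esub> g)) * \<phi> g) =
      (\<Sum>k\<in>carrier G. to_ac (u h) * to_ac (v k) * \<phi> (h \<otimes>\<^bsub>G\<^esub> k))"
      by (rule sum.reindex_bij_witness
            [where i = "\<lambda>k. h \<otimes>\<^bsub>G\<^esub> k" and j = "\<lambda>g. inv\<^bsub>G\<^esub> h \<otimes>\<^bsub>G\<^esub> g"])
        (use h in \<open>auto simp flip: m_assoc\<close>)
  qed
  finally show ?thesis .
qed

section \<open>Evaluating the two coset polynomials of an element\<close>

text \<open>
  The group \<open>D\<^sub>n\<close> is the union of the cosets \<open>b\<^sup>e \<langle>a\<rangle>\<close>, with \<open>e\<close> a truth value. Indexing \<open>P\<close>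
  (\<open>e = False\<close>) and \<open>Q\<close> (\<open>e = True\<close>) by the coset lets one multiplication formula serve both.
\<close>

definition coset_eval :: "nat \<Rightarrow> bool \<Rightarrow> (bool \<times> int \<Rightarrow> 'a::field) \<Rightarrow> 'a alg_closure \<Rightarrow> 'a alg_closure"
  where "coset_eval n e u z = eval_ac (if e then Q_poly n u else P_poly n u) z"

lemma coset_eval_sum:
  "coset_eval n e u z = (\<Sum>k\<in>{0..<int n}. to_ac (u (e, k)) * z powi k)"
proof -
  have "coset_eval n e u z = (\<Sum>i<n. to_ac (u (e, int i)) * z ^ i)"
    by (cases e) (simp_all add: coset_eval_def P_poly_def Q_poly_def eval_ac_sum eval_ac_monom)
  also have "\<dots> = (\<Sum>k\<in>{0..<int n}. to_ac (u (e, k)) * z powi k)"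
    by (rule sum.reindex_bij_witness[where i = nat and j = int]) auto
  finally show ?thesis .
qed

lemma power_int_mod_order:
  fixes z :: "'k::field"
  assumes "z ^ n = 1" "0 < n"
  shows "z powi (k mod int n) = z powi k"
proof -
  have z: "z \<noteq> 0" using assms by (cases n) auto
  have "z powi k = z powi (int n * (k div int n) + k mod int n)" by simp
  also have "\<dots> = (z powi int n) powi (k div int n) * z powi (k mod int n)"
    unfolding power_int_add[OF disjI1[OF z]] power_int_mult ..
  finally show ?thesis using assms(1) by simp
qed

lemma finite_carrier_dihedral: "finite (carrier (dihedral_group n))"
  by (simp add: dihedral_group_def)

text \<open>
  Since \<open>f(a) b = b f(a\<^bsup>-1\<^esup>)\<close>, the product of \<open>P\<^sub>1(a) + b Q\<^sub>1(a)\<close> and \<open>P\<^sub>2(a) + b Q\<^sub>2(a)\<close> has the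
  coset polynomials \<open>P\<^sub>1(a) P\<^sub>2(a) + Q\<^sub>1(a\<^bsup>-1\<^esup>) Q\<^sub>2(a)\<close> and \<open>Q\<^sub>1(a) P\<^sub>2(a) + P\<^sub>1(a\<^bsup>-1\<^esup>) Q\<^sub>2(a)\<close>.
  Reduction of exponents modulo \<open>n\<close> is invisible at an \<open>n\<close>-th root of unity.
\<close>

lemma coset_eval_mult:
  fixes u v :: "bool \<times> int \<Rightarrow> 'a::field"
  assumes z: "z ^ n = 1" and n: "0 < n"
  shows "coset_eval n e (u \<otimes>\<^bsub>dihedral_algebra n\<^esub> v) z =
    coset_eval n e u z * coset_eval n False v z +
    coset_eval n (\<not> e) u (inverse z) * coset_eval n True v z"
proof -
  let ?G = "dihedral_group n"
  let ?\<phi> = "\<lambda>(d, k). if d = e then z powi k else 0"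
  have carr: "carrier ?G = UNIV \<times> {0..<int n}" by (simp add: dihedral_group_def)
  have split: "(\<Sum>g\<in>carrier ?G. F g) =
      (\<Sum>k\<in>{0..<int n}. F (False, k)) + (\<Sum>k\<in>{0..<int n}. F (True, k))"
    for F :: "bool \<times> int \<Rightarrow> 'a alg_closure"
    unfolding carr by (simp add: sum.cartesian_product' UNIV_bool)
  have z0: "z \<noteq> 0" using z n by (cases n) auto
  have \<phi>: "?\<phi> ((d, i) \<otimes>\<^bsub>?G\<^esub> (c, k)) =
     (if (d \<noteq> c) = e then (if c then inverse z else z) powi i * z powi k else 0)" for d c i k
    using z0 by (simp add: dihedral_group_def power_int_mod_order[OF z n] power_int_diff
        power_int_add power_int_inverse power_int_minus divide_inverse mult.commute)
  have "coset_eval n e (u \<otimes>\<^bsub>dihedral_algebra n\<^esub> v) z =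
      (\<Sum>g\<in>carrier ?G. to_ac ((u \<otimes>\<^bsub>dihedral_algebra n\<^esub> v) g) * ?\<phi> g)"
    unfolding split coset_eval_sum by (cases e) simp_all
  also have "\<dots> = (\<Sum>h\<in>carrier ?G. \<Sum>k\<in>carrier ?G. to_ac (u h) * to_ac (v k) * ?\<phi> (h \<otimes>\<^bsub>?G\<^esub> k))"
    by (rule sum_convolution[OF group_dihedral_group[OF n] finite_carrier_dihedral])
  also have "\<dots> = coset_eval n e u z * coset_eval n False v z +
    coset_eval n (\<not> e) u (inverse z) * coset_eval n True v z"
    unfolding split \<phi> coset_eval_sum sum_product
    by (cases e) (simp_all add: mult_ac)
  finally show ?thesis .
qed

lemma coset_eval_add:
  "coset_eval n e (u \<oplus>\<^bsub>dihedral_algebra n\<^esub> v) z = coset_eval n e u z + coset_eval n e v z"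
  unfolding coset_eval_sum by (simp add: group_algebra_add sum.distrib distrib_right)

lemma coset_eval_zero: "coset_eval n e (\<lambda>g. 0) z = 0"
  unfolding coset_eval_sum by simp

text \<open>
  The bound \<open>n\<close> on the degrees of \<open>P\<close> and \<open>Q\<close> is no restriction on their values at \<open>n\<close>-th roots
  of unity: reduce modulo \<open>x\<^sup>n - 1\<close>.
\<close>

lemma ex_dihedral_element:
  fixes p q :: "'a::field poly"
  assumes "0 < n"
  obtains u where "u \<in> carrier (dihedral_algebra n)"
    "\<And>z. z ^ n = 1 \<Longrightarrow> coset_eval n False u z = eval_ac p z"
    "\<And>z. z ^ n = 1 \<Longrightarrow> coset_eval n True u z = eval_ac q z"
proof -
  let ?m = "Polynomial.monom 1 n - 1 :: 'a poly"
  have deg: "Polynomial.degree ?m = n"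
    using assms Polynomial.degree_add_eq_left[of "- 1" "Polynomial.monom 1 n :: 'a poly"]
    by (simp add: degree_monom_eq)
  then have m0: "?m \<noteq> 0" using assms by auto
  have small: "Polynomial.degree (t mod ?m) < n" for t
    using degree_mod_less[OF m0, of t] deg assms by auto
  define u where "u = (\<lambda>(e, k). if 0 \<le> k \<and> k < int n
     then poly.coeff ((if e then q else p) mod ?m) (nat k) else 0)"
  have mod: "(\<Sum>i<n. Polynomial.monom (poly.coeff (t mod ?m) i) i) = t mod ?m" for t
    using small[of t] by (intro poly_eqI) (auto simp: coeff_sum if_distrib coeff_eq_0 cong: if_cong)
  have "P_poly n u = p mod ?m" "Q_poly n u = q mod ?m"
    by (simp_all add: P_poly_def Q_poly_def u_def mod)
  moreover have "eval_ac (t mod ?m) z = eval_ac t z" if "z ^ n = 1" for t z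
  proof -
    have "eval_ac t z = eval_ac (t div ?m * ?m + t mod ?m) z"
      by (simp only: div_mult_mod_eq)
    also have "\<dots> = eval_ac (t mod ?m) z"
      unfolding eval_ac_add eval_ac_mult eval_ac_diff eval_ac_monom using that by simp
    finally show ?thesis by simp
  qed
  moreover have "u \<in> carrier (dihedral_algebra n)"
    by (auto simp: u_def group_algebra_carrier_iff dihedral_group_def)
  ultimately show ?thesis by (intro that[of u]) (auto simp: coset_eval_def)
qed

section \<open>The components and their left ideals\<close>

lemma mat2_nth [simp]:
  "mat2 a b c d $ 1 $ 1 = a" "mat2 a b c d $ 1 $ 2 = b"
  "mat2 a b c d $ 2 $ 1 = c" "mat2 a b c d $ 2 $ 2 = d"
  by (simp_all add: mat2_def)

lemma mat2_collapse: "mat2 (M $ 1 $ 1) (M $ 1 $ 2) (M $ 2 $ 1) (M $ 2 $ 2) = M"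
  by (simp add: vec_eq_iff forall_2)

lemma mat2_eq_iff [simp]: "mat2 a b c d = mat2 a' b' c' d' \<longleftrightarrow> a = a' \<and> b = b' \<and> c = c' \<and> d = d'"
  by (auto simp: vec_eq_iff forall_2)

lemma mat2_add: "mat2 a b c d + mat2 a' b' c' d' = mat2 (a + a') (b + b') (c + c') (d + d')"
  by (simp add: vec_eq_iff forall_2)

lemma mat2_mult:
  fixes a :: "'k::field"
  shows "mat2 a b c d ** mat2 a' b' c' d' =
    mat2 (a * a' + b * c') (a * b' + b * d') (c * a' + d * c') (c * b' + d * d')"
  by (simp add: vec_eq_iff forall_2 matrix_matrix_mult_def sum_2)

lemma mat2_zero: "0 = mat2 0 0 0 (0 :: 'k::field)"
  by (simp add: vec_eq_iff forall_2)

lemma mat2_one: "mat 1 = mat2 1 0 0 (1 :: 'k::field)"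
  by (simp add: vec_eq_iff forall_2 mat_def)

lemma matrices_over_eq:
  fixes F :: "'k::field set"
  shows "{M :: 'k^2^2. \<forall>i k. M $ i $ k \<in> F} = {mat2 a b c d | a b c d. a \<in> F \<and> b \<in> F \<and> c \<in> F \<and> d \<in> F}"
proof -
  have "\<exists>a b c d. M = mat2 a b c d \<and> a \<in> F \<and> b \<in> F \<and> c \<in> F \<and> d \<in> F"
    if "\<forall>i k. M $ i $ k \<in> F" for M :: "'k^2^2"
    using that by (intro exI[of _ "M $ 1 $ 1"] exI[of _ "M $ 1 $ 2"] exI[of _ "M $ 2 $ 1"]
        exI[of _ "M $ 2 $ 2"]) (simp add: mat2_collapse)
  then show ?thesis by (auto simp: forall_2)
qed

lemma cyc_zero: "(\<lambda>g. 0) = cyc 0 (0 :: 'k::field)"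
  by (auto simp: cyc_def)

lemma cyc_eq_iff [simp]: "cyc a b = cyc c d \<longleftrightarrow> a = c \<and> b = d"
proof
  assume eq: "cyc a b = cyc c d"
  show "a = c \<and> b = d"
    using fun_cong[OF eq, of 0] fun_cong[OF eq, of 1] by (simp add: cyc_def)
qed simp

lemma carrier_C2: "carrier (integer_mod_group 2) = {0, 1}"
  by (auto simp: carrier_integer_mod_group)

lemma carrier_C2_algebra:
  "carrier C2_algebra = {cyc a b | a b. a \<in> range to_ac \<and> b \<in> range to_ac}"
proof -
  have "u \<in> {cyc a b | a b. a \<in> range to_ac \<and> b \<in> range to_ac}"
    if "u \<in> carrier C2_algebra" for u :: "int \<Rightarrow> 'a alg_closure"
  proof -
    have u: "u g \<in> range to_ac" "g \<notin> {0, 1} \<Longrightarrow> u g = 0" for g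
      using that by (simp_all add: group_algebra_def carrier_C2)
    then have "u = cyc (u 0) (u 1)" by (auto simp: cyc_def)
    then show ?thesis using u(1) by blast
  qed
  moreover have "cyc a b \<in> carrier C2_algebra"
    if "a \<in> range to_ac" "b \<in> range to_ac" for a b :: "'a alg_closure"
    using that is_subfieldD(1)[OF is_subfield_range_to_ac]
    by (simp add: group_algebra_def carrier_C2 cyc_def)
  ultimately show ?thesis by blast
qed

lemma cyc_mult:
  "cyc a b \<otimes>\<^bsub>C2_algebra\<^esub> cyc c d = cyc (a * c + b * d) (a * d + b * c)"
  by (auto simp: group_algebra_mult carrier_C2 cyc_def fun_eq_iff)

text \<open>
  The two kinds of component algebras share the type of values, so their operations are given on
  the sum type; only values from the same summand are ever combined.
\<close>

fun comp_add :: "'a::field alg_closure component \<Rightarrow> 'a alg_closure component \<Rightarrow> 'a alg_closure component"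
where
  "comp_add (Inl a) (Inl b) = Inl (\<lambda>g. a g + b g)"
| "comp_add (Inr M) (Inr N) = Inr (M + N)"
| "comp_add _ _ = undefined"

fun comp_mult :: "'a::field alg_closure component \<Rightarrow> 'a alg_closure component \<Rightarrow> 'a alg_closure component"
where
  "comp_mult (Inl a) (Inl b) = Inl (a \<otimes>\<^bsub>C2_algebra\<^esub> b)"
| "comp_mult (Inr M) (Inr N) = Inr (M ** N)"
| "comp_mult _ _ = undefined"

lemma comp_add_cyclic: "comp_add (Inl (cyc a b)) (Inl (cyc c d)) = Inl (cyc (a + c) (b + d))"
  by (auto simp: cyc_def)

definition comp_left_ideal ::
    "nat \<Rightarrow> nat \<Rightarrow> (nat \<Rightarrow> 'a::field alg_closure) \<Rightarrow> nat \<Rightarrow> 'a alg_closure component set \<Rightarrow> bool"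
  where "comp_left_ideal n r \<alpha> j L \<longleftrightarrow>
    L \<subseteq> A_comp n r \<alpha> j \<and> zero_comp n j \<subseteq> L \<and>
    (\<forall>c\<in>L. \<forall>d\<in>L. comp_add c d \<in> L) \<and>
    (\<forall>a\<in>A_comp n r \<alpha> j. \<forall>c\<in>L. comp_mult a c \<in> L)"

lemma A_comp_cyclic:
  "j \<le> zeta n \<Longrightarrow> A_comp n r \<alpha> j = {Inl (cyc a b) | a b. a \<in> range to_ac \<and> b \<in> range to_ac}"
  by (auto simp: A_comp_def carrier_C2_algebra)

lemma A_comp_matrix:
  "zeta n < j \<Longrightarrow> A_comp n r \<alpha> j = {Inr (mat2 a b c d) | a b c d.
    a \<in> F_field n r \<alpha> j \<and> b \<in> F_field n r \<alpha> j \<and> c \<in> F_field n r \<alpha> j \<and> d \<in> F_field n r \<alpha> j}"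
  by (auto simp: A_comp_def matrices_over_eq)

lemma zero_comp_cyclic: "j \<le> zeta n \<Longrightarrow> zero_comp n j = {Inl (cyc 0 0)}"
  by (simp add: zero_comp_def cyc_zero)

lemma zero_comp_matrix: "zeta n < j \<Longrightarrow> zero_comp n j = {Inr (mat2 0 0 0 0)}"
  by (simp add: zero_comp_def mat2_zero)

lemma I_comp_cyclic:
  "j \<le> zeta n \<Longrightarrow> I_comp n r \<alpha> j x y =
    {Inl (cyc (a * (x + y) + b * (x - y)) (a * (x - y) + b * (x + y))) | a b.
      a \<in> range to_ac \<and> b \<in> range to_ac}"
  unfolding I_comp_def carrier_C2_algebra by (simp flip: cyc_mult) blast

lemma I_comp_matrix:
  "zeta n < j \<Longrightarrow> I_comp n r \<alpha> j x y =
    {Inr (mat2 (k * y) (- k * x) (t * y) (- t * x)) | k t.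
      k \<in> F_field n r \<alpha> j \<and> t \<in> F_field n r \<alpha> j}"
  by (auto simp: I_comp_def)

lemmas comp_matrix = A_comp_matrix zero_comp_matrix I_comp_matrix mat2_add mat2_mult

lemma comp_left_ideal_A:
  fixes \<alpha> :: "nat \<Rightarrow> 'a::field alg_closure"
  shows "comp_left_ideal n r \<alpha> j (A_comp n r \<alpha> j)"
proof (cases "j \<le> zeta n")
  case True
  define K where "K = range (to_ac :: 'a \<Rightarrow> _)"
  have "is_subfield K" by (simp add: K_def is_subfield_range_to_ac)
  note F = is_subfieldD[OF this]
  show ?thesis
    unfolding comp_left_ideal_def A_comp_cyclic[OF True] zero_comp_cyclic[OF True] K_def[symmetric]
    by (auto simp: comp_add_cyclic cyc_mult F simp del: comp_add.simps)
next
  case False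
  note F = is_subfieldD[OF F_field_is_subfield[of n r \<alpha> j]]
  show ?thesis unfolding comp_left_ideal_def
    using False by (auto simp: comp_matrix F)
qed

lemma comp_left_ideal_zero: "comp_left_ideal n r \<alpha> j (zero_comp n j)"
proof (cases "j \<le> zeta n")
  case True
  have "0 \<in> range to_ac" using is_subfieldD(1)[OF is_subfield_range_to_ac] .
  then show ?thesis
    unfolding comp_left_ideal_def A_comp_cyclic[OF True] zero_comp_cyclic[OF True]
    by (auto simp: comp_add_cyclic cyc_mult simp del: comp_add.simps)
next
  case False
  then show ?thesis unfolding comp_left_ideal_def
    using is_subfieldD(1)[OF F_field_is_subfield[of n r \<alpha> j]] by (auto simp: comp_matrix)
qed

text \<open>
  Left multiplication of a matrix whose rows are \<open>k\<close> and \<open>t\<close> times the row \<open>(y, -x)\<close> only changes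
  the coefficients \<open>k\<close> and \<open>t\<close>; in the commutative case \<open>I\<^sub>j(x, y)\<close> is a principal ideal.
\<close>

lemma comp_left_ideal_I:
  fixes \<alpha> :: "nat \<Rightarrow> 'a::field alg_closure"
  assumes "x \<in> F_field n r \<alpha> j" "y \<in> F_field n r \<alpha> j"
  shows "comp_left_ideal n r \<alpha> j (I_comp n r \<alpha> j x y)"
proof (cases "j \<le> zeta n")
  case True
  define K where "K = range (to_ac :: 'a \<Rightarrow> _)"
  have "is_subfield K" by (simp add: K_def is_subfield_range_to_ac)
  note F = is_subfieldD[OF this]
  have xy: "x \<in> K" "y \<in> K" using assms True by (simp_all add: F_field_def K_def)
  have mem: "Inl (cyc p q) \<in> I_comp n r \<alpha> j x y"
    if "p = a * (x + y) + b * (x - y)" "q = a * (x - y) + b * (x + y)" "a \<in> K" "b \<in> K" for p q a b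
    unfolding I_comp_cyclic[OF True] K_def[symmetric] using that by blast
  have "I_comp n r \<alpha> j x y \<subseteq> A_comp n r \<alpha> j"
    unfolding I_comp_cyclic[OF True] A_comp_cyclic[OF True] K_def[symmetric]
    by (auto intro!: F xy)
  moreover have "zero_comp n j \<subseteq> I_comp n r \<alpha> j x y"
    using mem[of 0 0 0 0] F(1) by (simp add: zero_comp_cyclic[OF True])
  moreover have "comp_add c d \<in> I_comp n r \<alpha> j x y"
    if cd: "c \<in> I_comp n r \<alpha> j x y" "d \<in> I_comp n r \<alpha> j x y" for c d
  proof -
    obtain a b a' b' where ab: "a \<in> K" "b \<in> K" "a' \<in> K" "b' \<in> K"
      and c: "c = Inl (cyc (a * (x + y) + b * (x - y)) (a * (x - y) + b * (x + y)))"
      and d: "d = Inl (cyc (a' * (x + y) + b' * (x - y)) (a' * (x - y) + b' * (x + y)))"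
      using cd unfolding I_comp_cyclic[OF True] K_def[symmetric] by blast
    show ?thesis unfolding c d comp_add_cyclic
      by (rule mem[of _ "a + a'" "b + b'"]) (simp_all add: ab F algebra_simps)
  qed
  moreover have "comp_mult e c \<in> I_comp n r \<alpha> j x y"
    if ec: "e \<in> A_comp n r \<alpha> j" "c \<in> I_comp n r \<alpha> j x y" for c e
  proof -
    obtain a b p q where ab: "a \<in> K" "b \<in> K" "p \<in> K" "q \<in> K"
      and c: "c = Inl (cyc (a * (x + y) + b * (x - y)) (a * (x - y) + b * (x + y)))"
      and e: "e = Inl (cyc p q)"
      using ec unfolding I_comp_cyclic[OF True] A_comp_cyclic[OF True] K_def[symmetric] by blast
    show ?thesis unfolding c e comp_mult.simps cyc_mult
      by (rule mem[of _ "p * a + q * b" "p * b + q * a"]) (simp_all add: ab F algebra_simps)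
  qed
  ultimately show ?thesis unfolding comp_left_ideal_def by blast
next
  case False
  then have j: "zeta n < j" by simp
  let ?F = "F_field n r \<alpha> j"
  note F = is_subfieldD[OF F_field_is_subfield[of n r \<alpha> j]]
  have mem: "Inr (mat2 a b c d) \<in> I_comp n r \<alpha> j x y"
    if "a = k * y" "b = - k * x" "c = t * y" "d = - t * x" "k \<in> ?F" "t \<in> ?F" for a b c d k t
    unfolding I_comp_matrix[OF j] using that by blast
  have "I_comp n r \<alpha> j x y \<subseteq> A_comp n r \<alpha> j"
    unfolding I_comp_matrix[OF j] A_comp_matrix[OF j]
    by (auto intro!: F assms)
  moreover have "zero_comp n j \<subseteq> I_comp n r \<alpha> j x y"
    using mem[of 0 0 0 0 0 0] F(1) by (simp add: zero_comp_matrix[OF j])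
  moreover have "comp_add c d \<in> I_comp n r \<alpha> j x y"
    if cd: "c \<in> I_comp n r \<alpha> j x y" "d \<in> I_comp n r \<alpha> j x y" for c d
  proof -
    obtain k t k' t' where kt: "k \<in> ?F" "t \<in> ?F" "k' \<in> ?F" "t' \<in> ?F"
      and c: "c = Inr (mat2 (k * y) (- k * x) (t * y) (- t * x))"
      and d: "d = Inr (mat2 (k' * y) (- k' * x) (t' * y) (- t' * x))"
      using cd unfolding I_comp_matrix[OF j] by blast
    show ?thesis unfolding c d comp_add.simps mat2_add
      by (rule mem[of _ "k + k'" _ _ "t + t'"]) (simp_all add: kt F algebra_simps)
  qed
  moreover have "comp_mult e c \<in> I_comp n r \<alpha> j x y"
    if ec: "e \<in> A_comp n r \<alpha> j" "c \<in> I_comp n r \<alpha> j x y" for c e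
  proof -
    obtain k t p q p' q' where kt: "k \<in> ?F" "t \<in> ?F" "p \<in> ?F" "q \<in> ?F" "p' \<in> ?F" "q' \<in> ?F"
      and c: "c = Inr (mat2 (k * y) (- k * x) (t * y) (- t * x))"
      and e: "e = Inr (mat2 p q p' q')"
      using ec unfolding I_comp_matrix[OF j] A_comp_matrix[OF j] by blast
    show ?thesis unfolding c e comp_mult.simps mat2_mult
      by (rule mem[of _ "p * k + q * t" _ _ "p' * k + q' * t"]) (simp_all add: kt F algebra_simps)
  qed
  ultimately show ?thesis unfolding comp_left_ideal_def by blast
qed

text \<open>
  A line in the plane is either vertical or the graph of multiplication by its slope. A
  subspace with a vector outside the line of slope \<open>x\<close> contains a vertical vector, the difference
  of that vector and the point of the line above the same abscissa, hence everything.
\<close>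

lemma plane_subspace_cases:
  fixes F :: "'k::field set"
  assumes F: "is_subfield F" and W: "W \<subseteq> F \<times> F" "(0, 0) \<in> W"
    and add: "\<And>a b c d. (a, b) \<in> W \<Longrightarrow> (c, d) \<in> W \<Longrightarrow> (a + c, b + d) \<in> W"
    and scale: "\<And>k a b. k \<in> F \<Longrightarrow> (a, b) \<in> W \<Longrightarrow> (k * a, k * b) \<in> W"
  obtains "W = {(0, 0)}" | "W = F \<times> F" | "W = (\<lambda>k. (0, k)) ` F"
  | x where "x \<in> F" "W = (\<lambda>k. (k, k * x)) ` F"
proof -
  note F' = is_subfieldD[OF F]
  have WF: "a \<in> F" "b \<in> F" if "(a, b) \<in> W" for a b using that W(1) by auto
  show ?thesis
  proof (cases "\<forall>(a, b)\<in>W. a = 0")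
    case True
    show ?thesis
    proof (cases "W = {(0, 0)}")
      case False
      then obtain b where b: "(0, b) \<in> W" "b \<noteq> 0" using True W(2) by fastforce
      have "(0, k) \<in> W" if "k \<in> F" for k
        using scale[OF F'(8)[OF that WF(2)[OF b(1)]] b(1)] b(2) by simp
      moreover have "W \<subseteq> (\<lambda>k. (0, k)) ` F" using True WF by fast
      ultimately have "W = (\<lambda>k. (0, k)) ` F" by blast
      then show ?thesis by (rule that(3))
    qed (rule that(1))
  next
    case False
    then obtain a b where ab: "(a, b) \<in> W" "a \<noteq> 0" by auto
    define x where "x = b / a"
    have x: "x \<in> F" unfolding x_def by (rule F'(8)[OF WF(2)[OF ab(1)] WF(1)[OF ab(1)]])
    have line: "(k, k * x) \<in> W" if "k \<in> F" for k
      using scale[OF F'(8)[OF that WF(1)[OF ab(1)]] ab(1)] ab(2) by (simp add: x_def)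
    show ?thesis
    proof (cases "W = (\<lambda>k. (k, k * x)) ` F")
      case False
      then obtain c d where cd: "(c, d) \<in> W" "(c, d) \<notin> (\<lambda>k. (k, k * x)) ` F"
        using line by force
      have c: "c \<in> F" and d: "d \<in> F" using WF[OF cd(1)] .
      have ne: "d - c * x \<noteq> 0" using cd(2) c by auto
      have e: "d - c * x \<in> F" using c d x by (intro F'(4,7))
      have vert: "(0, k) \<in> W" if "k \<in> F" for k
        using scale[OF F'(8)[OF that e] add[OF cd(1) line[OF F'(5)[OF c]]]] ne by simp
      have "(p, q) \<in> W" if "p \<in> F" "q \<in> F" for p q
        using add[OF line[OF that(1)] vert[OF F'(7)[OF that(2) F'(4)[OF that(1) x]]]] by simp
      then have "W = F \<times> F" using W(1) by auto
      then show ?thesis by (rule that(2))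
    qed (rule that(4)[OF x])
  qed
qed

text \<open>
  Replacing \<open>x\<close> by \<open>- x\<close> permutes the nonzero elements, so their product is multiplied by both
  \<open>1\<close> and \<open>(- 1)\<^bsup>q - 1\<^esup>\<close>, where the number \<open>q - 1\<close> of nonzero elements is odd.
\<close>

lemma even_card_imp_minus_one:
  assumes "even CARD('a::{field,finite})"
  shows "(- 1 :: 'a) = 1"
proof -
  let ?S = "UNIV - {0 :: 'a}"
  have "prod uminus ?S = prod (\<lambda>x. x) ?S"
    by (rule prod.reindex_bij_witness[of _ uminus uminus]) auto
  moreover have "prod uminus ?S = (- 1) ^ card ?S * prod (\<lambda>x. x) ?S"
    using prod.distrib[of "\<lambda>_. - 1" "\<lambda>x. x" ?S] by simp
  moreover have "prod (\<lambda>x. x) ?S \<noteq> 0" by simp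
  ultimately have "(- 1 :: 'a) ^ card ?S = 1" by simp
  moreover have "odd (card ?S)" using assms by (simp add: card_Diff_singleton)
  ultimately show ?thesis by simp
qed

text \<open>
  In coordinates \<open>a + b h\<close>, multiplication by \<open>h\<close> swaps \<open>a\<close> and \<open>b\<close>. An ideal is therefore a
  subspace of the plane that is stable under the swap; a stable line has slope \<open>1\<close> or \<open>- 1\<close>.
  The second line is recorded only if it differs from the first, that is, in odd characteristic;
  this is why \<open>I\<^sub>j(0, 1)\<close> can be avoided when \<open>q\<close> is even.
\<close>

lemma comp_left_ideal_cyclic_cases:
  fixes \<alpha> :: "nat \<Rightarrow> 'a::{field,finite} alg_closure"
  assumes L: "comp_left_ideal n r \<alpha> j L" and j: "j \<le> zeta n"
  shows "L = A_comp n r \<alpha> j \<or> (L = I_comp n r \<alpha> j 0 1 \<and> odd CARD('a)) \<or> L = I_comp n r \<alpha> j 1 0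
    \<or> L = zero_comp n j"
proof -
  define K where "K = range (to_ac :: 'a \<Rightarrow> _)"
  have F: "is_subfield K" by (simp add: K_def is_subfield_range_to_ac)
  note F' = is_subfieldD[OF F]
  define W where "W = {(a, b). Inl (cyc a b) \<in> L}"
  have A: "A_comp n r \<alpha> j = {Inl (cyc a b) | a b. a \<in> K \<and> b \<in> K}"
    unfolding K_def by (rule A_comp_cyclic[OF j])
  have L_eq: "L = (\<lambda>(a, b). Inl (cyc a b)) ` W"
    using L unfolding comp_left_ideal_def A W_def by (auto simp: image_iff)
  have W: "W \<subseteq> K \<times> K"
    using L unfolding comp_left_ideal_def A W_def by auto
  have W0: "(0, 0) \<in> W"
    using L j unfolding comp_left_ideal_def W_def by (simp add: zero_comp_cyclic)
  have add: "(a + c, b + d) \<in> W" if "(a, b) \<in> W" "(c, d) \<in> W" for a b c d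
    using L that unfolding comp_left_ideal_def W_def by (simp flip: comp_add_cyclic del: comp_add.simps)
  have mult: "(p * a + q * b, p * b + q * a) \<in> W" if "p \<in> K" "q \<in> K" "(a, b) \<in> W" for p q a b
  proof -
    have "comp_mult (Inl (cyc p q)) (Inl (cyc a b)) \<in> L"
      using L that unfolding comp_left_ideal_def A W_def by blast
    then show ?thesis by (simp add: W_def cyc_mult)
  qed
  have scale: "(k * a, k * b) \<in> W" if "k \<in> K" "(a, b) \<in> W" for k a b
    using mult[OF that(1) F'(1) that(2)] by simp
  have swap: "(b, a) \<in> W" if "(a, b) \<in> W" for a b
    using mult[OF F'(1,2) that] by simp
  note I = I_comp_cyclic[OF j, of r \<alpha>, folded K_def]
  show ?thesis
  proof (rule plane_subspace_cases[OF F W W0 add scale])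
    assume "W = {(0, 0)}"
    then show ?thesis by (simp add: L_eq zero_comp_cyclic[OF j])
  next
    assume "W = K \<times> K"
    then have "L = A_comp n r \<alpha> j" unfolding L_eq A by auto
    then show ?thesis by blast
  next
    assume eq: "W = (\<lambda>k. (0, k)) ` K"
    then have "(0, 1) \<in> W" using F'(2) by auto
    then have "(1, 0) \<in> W" by (rule swap)
    then show ?thesis unfolding eq by auto
  next
    fix x assume x: "x \<in> K" and eq: "W = (\<lambda>k. (k, k * x)) ` K"
    then have "(1, x) \<in> W" using F'(2) by auto
    then have "(x, 1) \<in> W" by (rule swap)
    then have "x * x = 1" unfolding eq by auto
    then consider "x = 1" | "x = - 1" "x \<noteq> 1" using square_eq_1_iff[of x] by blast
    then show ?thesis
    proof cases
      case 1
      have "L = (\<lambda>k. Inl (cyc k k)) ` K" unfolding L_eq eq 1 by (auto simp: image_iff)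
      also have "\<dots> = I_comp n r \<alpha> j 1 0"
      proof -
        have "Inl (cyc (k * (1 + 0) + 0 * (1 - 0)) (k * (1 - 0) + 0 * (1 + 0)))
            \<in> I_comp n r \<alpha> j 1 0" if "k \<in> K" for k
          unfolding I using that F'(1) by blast
        then have "Inl (cyc k k) \<in> I_comp n r \<alpha> j 1 0" if "k \<in> K" for k
          using that by simp
        moreover have "I_comp n r \<alpha> j 1 0 \<subseteq> (\<lambda>k. Inl (cyc k k)) ` K"
          unfolding I by (auto intro!: F' image_eqI)
        ultimately show ?thesis by blast
      qed
      finally show ?thesis by blast
    next
      case 2
      have odd: "odd CARD('a)"
      proof
        assume "even CARD('a)"
        then have "to_ac (- 1 :: 'a) = to_ac 1" by (simp only: even_card_imp_minus_one)
        then show False using 2 by simp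
      qed
      have "L = (\<lambda>k. Inl (cyc k (- k))) ` K" unfolding L_eq eq 2(1) by (auto simp: image_iff)
      also have "\<dots> = I_comp n r \<alpha> j 0 1"
      proof -
        have "Inl (cyc (k * (0 + 1) + 0 * (0 - 1)) (k * (0 - 1) + 0 * (0 + 1)))
            \<in> I_comp n r \<alpha> j 0 1" if "k \<in> K" for k
          unfolding I using that F'(1) by blast
        then have "Inl (cyc k (- k)) \<in> I_comp n r \<alpha> j 0 1" if "k \<in> K" for k
          using that by simp
        moreover have "Inl (cyc (a - b) (b - a)) \<in> (\<lambda>k. Inl (cyc k (- k))) ` K"
          if "a \<in> K" "b \<in> K" for a b
          using F'(7)[OF that] by (auto simp: image_iff intro!: bexI[of _ "a - b"])
        then have "I_comp n r \<alpha> j 0 1 \<subseteq> (\<lambda>k. Inl (cyc k (- k))) ` K"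
          unfolding I by auto
        ultimately show ?thesis by blast
      qed
      finally show ?thesis using odd by blast
    qed
  qed
qed

text \<open>
  Multiplying by matrix units on the left moves rows around freely, so a left ideal of \<open>2 \<times> 2\<close>
  matrices consists of all matrices with both rows in one subspace \<open>W\<close> of the plane. A line \<open>W\<close>
  of slope \<open>x\<close> gives \<open>I\<^sub>j(-x, 1)\<close>, the vertical line gives \<open>I\<^sub>j(1, 0)\<close>.
\<close>

lemma comp_left_ideal_matrix_cases:
  assumes L: "comp_left_ideal n r \<alpha> j L" and j: "zeta n < j"
  shows "L = A_comp n r \<alpha> j \<or> L = I_comp n r \<alpha> j 0 1 \<or> L = I_comp n r \<alpha> j 1 0
    \<or> (\<exists>x\<in>F_field n r \<alpha> j. x \<noteq> 0 \<and> L = I_comp n r \<alpha> j (- x) 1) \<or> L = zero_comp n j"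
proof -
  define F where "F = F_field n r \<alpha> j"
  have F: "is_subfield F" by (simp add: F_def F_field_is_subfield)
  note F' = is_subfieldD[OF F]
  note A = A_comp_matrix[OF j, of r \<alpha>, folded F_def]
  note I = I_comp_matrix[OF j, of r \<alpha>, folded F_def]
  define W where "W = {(a, b). Inr (mat2 a b 0 0) \<in> L}"
  have mult: "Inr (mat2 (p * a + q * c) (p * b + q * d) (p' * a + q' * c) (p' * b + q' * d)) \<in> L"
    if "p \<in> F" "q \<in> F" "p' \<in> F" "q' \<in> F" "Inr (mat2 a b c d) \<in> L" for p q p' q' a b c d
  proof -
    have "comp_mult (Inr (mat2 p q p' q')) (Inr (mat2 a b c d)) \<in> L"
      using L that unfolding comp_left_ideal_def A by blast
    then show ?thesis by (simp add: mat2_mult)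
  qed
  have sum: "Inr (mat2 (a + a') (b + b') (c + c') (d + d')) \<in> L"
    if "Inr (mat2 a b c d) \<in> L" "Inr (mat2 a' b' c' d') \<in> L" for a b c d a' b' c' d'
  proof -
    have "comp_add (Inr (mat2 a b c d)) (Inr (mat2 a' b' c' d')) \<in> L"
      using L that unfolding comp_left_ideal_def by blast
    then show ?thesis by (simp add: mat2_add)
  qed
  have rows: "Inr (mat2 a b c d) \<in> L \<longleftrightarrow> (a, b) \<in> W \<and> (c, d) \<in> W" for a b c d
  proof
    assume "Inr (mat2 a b c d) \<in> L"
    then show "(a, b) \<in> W \<and> (c, d) \<in> W"
      using mult[of 1 0 0 0 a b c d] mult[of 0 1 0 0 a b c d] F'(1,2) by (simp add: W_def)
  next
    assume "(a, b) \<in> W \<and> (c, d) \<in> W"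
    then have "Inr (mat2 a b 0 0) \<in> L" "Inr (mat2 0 0 c d) \<in> L"
      using mult[of 0 0 1 0 c d 0 0] F'(1,2) by (simp_all add: W_def)
    from sum[OF this] show "Inr (mat2 a b c d) \<in> L" by simp
  qed
  have L_eq: "L = {Inr (mat2 a b c d) | a b c d. (a, b) \<in> W \<and> (c, d) \<in> W}"
  proof -
    have "L \<subseteq> A_comp n r \<alpha> j" using L by (simp add: comp_left_ideal_def)
    then have "\<exists>a b c d. m = Inr (mat2 a b c d)" if "m \<in> L" for m using that unfolding A by blast
    then show ?thesis using rows by blast
  qed
  have W: "W \<subseteq> F \<times> F"
    using L unfolding comp_left_ideal_def A W_def by auto
  have W0: "(0, 0) \<in> W"
    using L j unfolding comp_left_ideal_def W_def by (simp add: zero_comp_matrix)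
  have add: "(a + c, b + d) \<in> W" if "(a, b) \<in> W" "(c, d) \<in> W" for a b c d
    using sum[of a b 0 0 c d 0 0] that by (simp add: W_def)
  have scale: "(k * a, k * b) \<in> W" if "k \<in> F" "(a, b) \<in> W" for k a b
    using mult[of k 0 0 0 a b 0 0] that F'(1) by (simp add: W_def)
  show ?thesis
  proof (rule plane_subspace_cases[OF F W W0 add scale])
    assume "W = {(0, 0)}"
    then show ?thesis by (simp add: L_eq zero_comp_matrix[OF j])
  next
    assume "W = F \<times> F"
    then have "L = A_comp n r \<alpha> j" unfolding L_eq A by auto
    then show ?thesis by blast
  next
    assume W: "W = (\<lambda>k. (0, k)) ` F"
    have "L = {Inr (mat2 0 k 0 t) | k t. k \<in> F \<and> t \<in> F}" unfolding L_eq W by blast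
    also have "\<dots> = I_comp n r \<alpha> j 1 0"
    proof -
      have "Inr (mat2 0 k 0 t) \<in> I_comp n r \<alpha> j 1 0" if "k \<in> F" "t \<in> F" for k t
      proof -
        have "Inr (mat2 (- k * 0) (- (- k) * 1) (- t * 0) (- (- t) * 1)) \<in> I_comp n r \<alpha> j 1 0"
          unfolding I using F'(5)[OF that(1)] F'(5)[OF that(2)] by blast
        then show ?thesis by simp
      qed
      moreover have "I_comp n r \<alpha> j 1 0 \<subseteq> {Inr (mat2 0 k 0 t) | k t. k \<in> F \<and> t \<in> F}"
        unfolding I by (auto intro!: F'(5))
      ultimately show ?thesis by blast
    qed
    finally show ?thesis by blast
  next
    fix x assume x: "x \<in> F" and W: "W = (\<lambda>k. (k, k * x)) ` F"
    have "L = {Inr (mat2 k (k * x) t (t * x)) | k t. k \<in> F \<and> t \<in> F}" unfolding L_eq W by blast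
    then have "L = I_comp n r \<alpha> j (- x) 1" unfolding I by simp
    then show ?thesis using x by (cases "x = 0") (auto simp: F_def)
  qed
qed

section \<open>The representations of the dihedral algebra\<close>

text \<open>
  The matrix \<open>Z\<^sub>j\<close> that defines \<open>\<sigma>\<^sub>j\<close>, for \<open>z = \<alpha>\<^sub>j\<close>.
\<close>

definition conj_matrix :: "'k::field \<Rightarrow> 'k^2^2" where
  "conj_matrix z = mat2 1 (- z) 1 (- inverse z)"

lemma conj_matrix_inverse:
  fixes z :: "'k::field"
  assumes "z \<noteq> 0" "z \<noteq> inverse z"
  shows "conj_matrix z ** matrix_inv (conj_matrix z) = mat 1"
    "matrix_inv (conj_matrix z) ** conj_matrix z = mat 1"
proof -
  define d where "d = z - inverse z"
  have d: "d \<noteq> 0" using assms(2) by (simp add: d_def)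
  have "conj_matrix z ** mat2 (- inverse z / d) (z / d) (- 1 / d) (1 / d) = mat 1"
    unfolding conj_matrix_def mat2_mult mat2_one mat2_eq_iff using d assms(1)
    by (simp add: divide_simps) (simp add: d_def algebra_simps)
  then have "invertible (conj_matrix z)" unfolding invertible_right_inverse by blast
  then have "\<exists>B. conj_matrix z ** B = mat 1 \<and> B ** conj_matrix z = mat 1"
    by (simp add: invertible_def)
  from someI_ex[OF this]
  show "conj_matrix z ** matrix_inv (conj_matrix z) = mat 1"
    "matrix_inv (conj_matrix z) ** conj_matrix z = mat 1"
    unfolding matrix_inv_def by blast+
qed

lemma sigma_eq: "sigma z M = matrix_inv (conj_matrix z) ** M ** conj_matrix z"
  by (simp add: sigma_def conj_matrix_def Let_def)

lemma sigma_mult: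
  assumes "z \<noteq> 0" "z \<noteq> inverse z"
  shows "sigma z (M ** N) = sigma z M ** sigma z N"
proof -
  let ?Z = "conj_matrix z"
  have "sigma z M ** sigma z N =
      matrix_inv ?Z ** M ** (?Z ** matrix_inv ?Z) ** N ** ?Z"
    by (simp only: sigma_eq matrix_mul_assoc)
  then show ?thesis
    by (simp only: conj_matrix_inverse[OF assms] sigma_eq matrix_mul_rid matrix_mul_assoc)
qed

lemma sigma_add: "sigma (z :: 'a::field) (M + N) = sigma z M + sigma z N"
proof -
  have "(A + B) ** C = A ** C + B ** C" for A B C :: "'a^2^2"
    by (simp add: vec_eq_iff matrix_matrix_mult_def sum.distrib distrib_right)
  then show ?thesis by (simp add: sigma_eq matrix_add_ldistrib)
qed

lemma sigma_zero: "sigma z 0 = 0"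
  by (simp add: sigma_eq vec_eq_iff matrix_matrix_mult_def)

text \<open>
  Matrices of the form on the left are linear combinations, with coefficients \<open>x\<close>, \<open>y\<close>, \<open>v\<close>,
  \<open>w\<close>, of the images under \<open>\<tau>\<^sub>j\<close> of \<open>1\<close>, \<open>a\<close>, \<open>b\<close> and \<open>- a b\<close>. After conjugation the entries
  involve \<open>z\<close> only through \<open>\<beta>\<close>, which is how the smaller field \<open>F\<^sub>j\<close> enters.
\<close>

lemma sigma_mat2:
  fixes z x y v w :: "'k::field"
  assumes "z \<noteq> 0" "z \<noteq> inverse z"
  defines "\<beta> \<equiv> z + inverse z"
  shows "sigma z (mat2 (x + y * z) (v - w * z) (v - w * inverse z) (x + y * inverse z)) =
    mat2 (x + v) (y - \<beta> * v + w) (w - y) (x + \<beta> * y - v)" (is "sigma z ?X = ?M")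
proof -
  have "?X ** conj_matrix z = conj_matrix z ** ?M"
    using assms(1) by (simp add: conj_matrix_def mat2_mult \<beta>_def algebra_simps)
  then have "sigma z ?X = (matrix_inv (conj_matrix z) ** conj_matrix z) ** ?M"
    by (simp only: sigma_eq matrix_mul_assoc[symmetric])
  then show ?thesis by (simp only: conj_matrix_inverse[OF assms(1,2)] matrix_mul_lid)
qed

text \<open>
  Both \<open>z\<close> and its inverse are roots of \<open>X\<^sup>2 - \<beta> X + 1\<close> with \<open>\<beta> = z + z\<^bsup>-1\<^esup>\<close>, so reducing a polynomial
  modulo this quadratic yields one linear expression that is valid at both points.
\<close>

lemma eval_ac_reciprocal_pair:
  fixes p :: "'a::field poly"
  assumes z: "z \<noteq> 0"
  obtains x y where "x \<in> adjoin (z + inverse z)" "y \<in> adjoin (z + inverse z)"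
    "eval_ac p z = x + y * z" "eval_ac p (inverse z) = x + y * inverse z"
proof -
  define \<beta> where "\<beta> = z + inverse z"
  note F = is_subfieldD[OF is_subfield_adjoin[of \<beta>]]
  have \<beta>: "\<beta> \<in> adjoin \<beta>" using adjoinI[of "[:0, 1:]" \<beta>] by (simp add: eval_ac_pCons)
  have base: "to_ac c \<in> adjoin \<beta>" for c :: 'a
    using adjoinI[of "[:c:]" \<beta>] by (simp add: eval_ac_pCons)
  have "\<exists>x\<in>adjoin \<beta>. \<exists>y\<in>adjoin \<beta>.
    eval_ac p z = x + y * z \<and> eval_ac p (inverse z) = x + y * inverse z"
  proof (induction p)
    case 0
    show ?case using F(1) by (intro bexI[of _ 0]) auto
  next
    case (pCons c p)
    then obtain x y where xy: "x \<in> adjoin \<beta>" "y \<in> adjoin \<beta>"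
      "eval_ac p z = x + y * z" "eval_ac p (inverse z) = x + y * inverse z" by blast
    have "eval_ac (pCons c p) z = (to_ac c - y) + (x + y * \<beta>) * z"
      "eval_ac (pCons c p) (inverse z) = (to_ac c - y) + (x + y * \<beta>) * inverse z"
      using z by (simp_all add: eval_ac_pCons xy(3,4) \<beta>_def algebra_simps)
    moreover have "to_ac c - y \<in> adjoin \<beta>" "x + y * \<beta> \<in> adjoin \<beta>"
      using xy(1,2) base \<beta> by (auto intro: F(3,4,7))
    ultimately show ?case by blast
  qed
  then show ?thesis using that unfolding \<beta>_def by blast
qed

lemma tau_eq: "tau n z u = mat2 (coset_eval n False u z) (coset_eval n True u (inverse z))
    (coset_eval n True u z) (coset_eval n False u (inverse z))"
  by (simp add: tau_def coset_eval_def)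

lemma tau_mult:
  assumes "z ^ n = 1" "0 < n"
  shows "tau n z (u \<otimes>\<^bsub>dihedral_algebra n\<^esub> v) = tau n z u ** tau n z v"
proof -
  have "inverse z ^ n = 1" using assms(1) by (simp add: power_inverse)
  then show ?thesis
    using assms by (simp add: tau_eq mat2_mult coset_eval_mult algebra_simps)
qed

definition component ::
    "nat \<Rightarrow> nat \<Rightarrow> (nat \<Rightarrow> 'a::field alg_closure) \<Rightarrow> (bool \<times> int \<Rightarrow> 'a) \<Rightarrow> nat \<Rightarrow> 'a alg_closure component"
where
  "component n r \<alpha> u j =
    (if j \<le> zeta n then Inl (gamma n j u)
     else if j \<le> r then Inr (sigma (\<alpha> j) (tau n (\<alpha> j) u))
     else Inr (tau n (\<alpha> j) u))"

lemma P_map_eq_restrict: "P_map n r s \<alpha> u = restrict (component n r \<alpha> u) {1..r+s}"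
  by (simp add: P_map_def component_def restrict_def fun_eq_iff)

section \<open>The factorization and its roots\<close>

locale dihedral_decomposition =
  fixes n r s :: nat and f :: "nat \<Rightarrow> 'a::field poly" and \<alpha> :: "nat \<Rightarrow> 'a alg_closure"
  assumes n_ge_2: "n \<ge> 2"
    and factorization: "dihedral_factorization n r s f"
    and root: "\<forall>j\<in>{1..r+s}. eval_ac (f j) (\<alpha> j) = 0"
begin

abbreviation indices :: "nat set" where "indices \<equiv> {1..r+s}"

definition factors :: "'a poly set" where
  "factors = f ` indices \<union> (\<lambda>j. monic_reciprocal (f j)) ` {r+1..r+s}"

text \<open>
  The factor of \<open>x\<^sup>n - 1\<close> that has \<open>\<alpha>\<^sub>j\<^bsup>-1\<^esup>\<close> as a root.
\<close>

definition inverse_factor :: "nat \<Rightarrow> 'a poly" where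
  "inverse_factor j = (if j \<le> r then f j else monic_reciprocal (f j))"

lemma n_pos: "0 < n" using n_ge_2 by simp

lemmas factorization_conjuncts = factorization[unfolded dihedral_factorization_def]

lemma zeta_le_r: "zeta n \<le> r"
  and inj_f: "inj_on f indices"
  and inj_reciprocal: "inj_on (\<lambda>j. monic_reciprocal (f j)) {r+1..r+s}"
  and disjoint_reciprocal: "f ` indices \<inter> (\<lambda>j. monic_reciprocal (f j)) ` {r+1..r+s} = {}"
  and f_1: "f 1 = [:-1, 1:]"
  and f_2: "even n \<Longrightarrow> f 2 = [:1, 1:]"
  using factorization_conjuncts by blast+

lemma factors_irreducible:
  assumes "p \<in> factors" shows "Factorial_Ring.irreducible p \<and> lead_coeff p = 1"
proof (cases "p \<in> f ` indices")
  case True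
  then show ?thesis using factorization_conjuncts by blast
next
  case False
  then obtain j where j: "j \<in> {r+1..r+s}" "p = monic_reciprocal (f j)"
    using assms by (auto simp: factors_def)
  have irr: "Factorial_Ring.irreducible p"
    using factorization_conjuncts j by blast
  then have "reflect_poly (f j) \<noteq> 0" by (auto simp: j(2) monic_reciprocal_def)
  then have "lead_coeff p = 1"
    unfolding j(2) monic_reciprocal_def lead_coeff_smult by simp
  then show ?thesis using irr by simp
qed

lemma finite_factors: "finite factors" by (simp add: factors_def)

lemma f_in_factors: "j \<in> indices \<Longrightarrow> f j \<in> factors" by (simp add: factors_def)

lemma inverse_factor_in_factors: "j \<in> indices \<Longrightarrow> inverse_factor j \<in> factors"
  by (auto simp: factors_def inverse_factor_def)

lemma f_eq_iff: "j \<in> indices \<Longrightarrow> k \<in> indices \<Longrightarrow> f j = f k \<longleftrightarrow> j = k"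
  by (rule inj_on_eq_iff[OF inj_f])

lemma factors_of_distinct_indices:
  assumes "j \<in> indices" "k \<in> indices" "j \<noteq> k"
  shows "{f j, inverse_factor j} \<inter> {f k, inverse_factor k} = {}"
proof -
  let ?h = "\<lambda>j. monic_reciprocal (f j)"
  have 1: "f i \<noteq> f l" if "i \<in> indices" "l \<in> indices" "i \<noteq> l" for i l
    using f_eq_iff that by blast
  have 2: "f i \<noteq> ?h l" if "i \<in> indices" "l \<in> indices" "\<not> l \<le> r" for i l
  proof -
    have "l \<in> {r+1..r+s}" using that by simp
    then show ?thesis using disjoint_reciprocal that(1) by blast
  qed
  have 3: "?h j \<noteq> ?h k" if "\<not> j \<le> r" "\<not> k \<le> r"
    using inj_onD[OF inj_reciprocal, of j k] assms that by auto
  show ?thesis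
    using 1[OF assms] 2[OF assms(1,2)] 2[OF assms(2,1)] 3 by (auto simp: inverse_factor_def)
qed

lemma f_dvd:
  assumes "j \<in> indices"
  shows "f j dvd Polynomial.monom 1 n - 1"
proof -
  have eq: "Polynomial.monom 1 n - 1
       = (\<Prod>j\<in>{1..r}. f j) * (\<Prod>j\<in>{r+1..r+s}. f j * monic_reciprocal (f j))"
    using factorization_conjuncts by blast
  show ?thesis
  proof (cases "j \<le> r")
    case True
    then have "f j dvd (\<Prod>j\<in>{1..r}. f j)" using assms by (intro dvd_prodI) auto
    then show ?thesis unfolding eq by (rule dvd_mult2)
  next
    case False
    then have "f j * monic_reciprocal (f j) dvd (\<Prod>j\<in>{r+1..r+s}. f j * monic_reciprocal (f j))"
      using assms by (intro dvd_prodI) auto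
    then show ?thesis unfolding eq by (intro dvd_mult) (rule dvd_mult_left)
  qed
qed

lemma root_of_unity:
  assumes "j \<in> indices"
  shows "\<alpha> j ^ n = 1"
proof -
  obtain g where g: "Polynomial.monom 1 n - 1 = f j * g" using f_dvd[OF assms] by blast
  have "eval_ac (Polynomial.monom 1 n - 1) (\<alpha> j) = 0"
    unfolding g eval_ac_mult using root assms by simp
  then show ?thesis by (simp add: eval_ac_diff eval_ac_monom)
qed

lemma inverse_root_of_unity: "j \<in> indices \<Longrightarrow> inverse (\<alpha> j) ^ n = 1"
  by (simp add: power_inverse root_of_unity)

lemma root_nonzero: "j \<in> indices \<Longrightarrow> \<alpha> j \<noteq> 0"
  using root_of_unity[of j] n_pos by (cases n) auto

lemma rational_root:
  assumes "j \<in> indices" "j \<le> zeta n"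
  shows "\<alpha> j = to_ac (if j = 1 then 1 else - 1)"
proof -
  note f = f_1[unfolded One_nat_def] f_2
  have "eval_ac (f j) (\<alpha> j) = 0" using root assms(1) by blast
  moreover have "j = 1 \<or> (j = 2 \<and> even n)"
    using assms by (auto simp: zeta_def split: if_splits)
  ultimately show ?thesis
    by (auto simp: f eval_ac_pCons eq_neg_iff_add_eq_0 add.commute)
qed

lemma rational_root_inverse: "j \<in> indices \<Longrightarrow> j \<le> zeta n \<Longrightarrow> inverse (\<alpha> j) = \<alpha> j"
  by (simp add: rational_root)

lemma inverse_root:
  assumes "j \<in> indices"
  shows "eval_ac (inverse_factor j) (inverse (\<alpha> j)) = 0"
proof -
  have refl: "eval_ac (reflect_poly (f j)) (inverse (\<alpha> j)) = 0"
    using root root_nonzero assms by (simp add: eval_ac_reflect_poly)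
  consider "j = 1" | "j \<in> {2..r}" | "\<not> j \<le> r" using assms by force
  then show ?thesis
  proof cases
    case 1
    then have "j \<le> zeta n" by (simp add: zeta_def)
    then show ?thesis
      using 1 root assms zeta_le_r rational_root_inverse by (simp add: inverse_factor_def)
  next
    case 2
    then have "reflect_poly (f j) = f j"
      using factorization_conjuncts by blast
    then show ?thesis using 2 refl by (simp add: inverse_factor_def)
  next
    case 3
    then show ?thesis using refl by (simp add: inverse_factor_def monic_reciprocal_def eval_ac_smult)
  qed
qed

lemma distinct_factors_no_common_root:
  assumes "p \<in> factors" "q \<in> factors" "p \<noteq> q" "eval_ac p z = 0"
  shows "eval_ac q z \<noteq> 0"
proof
  assume "eval_ac q z = 0"
  obtain e where "\<And>q z. q \<in> {p} \<Longrightarrow> eval_ac q z = 0 \<Longrightarrow> eval_ac e z = 1"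
    "\<And>q z. q \<in> factors - {p} \<Longrightarrow> eval_ac q z = 0 \<Longrightarrow> eval_ac e z = 0"
    using crt_idempotent[OF finite_factors, of "{p}"] factors_irreducible assms(1) by blast
  from this(1)[of p z] this(2)[of q z] show False
    using assms \<open>eval_ac q z = 0\<close> by simp
qed

text \<open>
  A root equal to its inverse is \<open>1\<close> or \<open>- 1\<close>. These are roots of \<open>f\<^sub>1\<close> and, for even \<open>n\<close>, of
  \<open>f\<^sub>2\<close>; for odd \<open>n\<close> the element \<open>- 1\<close> is an \<open>n\<close>-th root of unity only if it equals \<open>1\<close>.
\<close>

lemma root_ne_inverse:
  assumes "j \<in> indices" "zeta n < j"
  shows "\<alpha> j \<noteq> inverse (\<alpha> j)"
proof
  assume "\<alpha> j = inverse (\<alpha> j)"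
  then have "\<alpha> j * \<alpha> j = 1" using root_nonzero[OF assms(1)] by (metis right_inverse)
  then have pm: "\<alpha> j = 1 \<or> \<alpha> j = - 1" by (simp add: square_eq_1_iff)
  note f = f_1[unfolded One_nat_def] f_2
  have no_root: "eval_ac (f k) (\<alpha> j) \<noteq> 0" if "k \<le> zeta n" "1 \<le> k" for k
    using that assms distinct_factors_no_common_root[of "f j" "f k" "\<alpha> j"] root f_eq_iff[of j k]
      f_in_factors by auto
  have ne1: "\<alpha> j \<noteq> 1"
    using no_root[of 1] by (auto simp: f eval_ac_pCons zeta_def)
  show False
  proof (cases "even n")
    case True
    then have "\<alpha> j \<noteq> - 1"
      using no_root[of 2] by (auto simp: f eval_ac_pCons zeta_def)
    then show False using pm ne1 by simp
  next
    case False
    then show False using pm ne1 root_of_unity[OF assms(1)] by auto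
  qed
qed

text \<open>
  The points \<open>\<alpha>\<^sub>k\<close> and \<open>\<alpha>\<^sub>k\<^bsup>-1\<^esup>\<close> carry the \<open>k\<close>-th component; a polynomial that tells the pairs of
  different indices apart projects onto a single component.
\<close>

lemma index_idempotent:
  assumes "j \<in> indices"
  obtains e where
    "\<And>k z. k \<in> indices \<Longrightarrow> z \<in> {\<alpha> k, inverse (\<alpha> k)} \<Longrightarrow> eval_ac e z = (if k = j then 1 else 0)"
proof -
  let ?T = "{f j, inverse_factor j}"
  obtain e where e: "\<And>q z. q \<in> ?T \<Longrightarrow> eval_ac q z = 0 \<Longrightarrow> eval_ac e z = 1"
    "\<And>q z. q \<in> factors - ?T \<Longrightarrow> eval_ac q z = 0 \<Longrightarrow> eval_ac e z = 0"
    using crt_idempotent[OF finite_factors, of ?T] factors_irreducible f_in_factors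
      inverse_factor_in_factors assms by blast
  show ?thesis
  proof (rule that)
    fix k z assume k: "k \<in> indices" and z: "z \<in> {\<alpha> k, inverse (\<alpha> k)}"
    have "\<exists>q\<in>{f k, inverse_factor k}. eval_ac q z = 0"
      using root inverse_root k z by blast
    then obtain q where q: "q \<in> {f k, inverse_factor k}" "eval_ac q z = 0" by blast
    show "eval_ac e z = (if k = j then 1 else 0)"
    proof (cases "k = j")
      case True
      then show ?thesis using e(1) q by simp
    next
      case False
      then have "q \<in> factors - ?T"
        using factors_of_distinct_indices[OF k assms] q(1) f_in_factors[OF k]
          inverse_factor_in_factors[OF k] by blast
      then show ?thesis using e(2) q(2) False by simp
    qed
  qed
qed

text \<open>
  Beyond \<open>r\<close> the two points belong to different irreducible factors, so values at them can be
  prescribed independently.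
\<close>

lemma separate_root_from_inverse:
  assumes "j \<in> indices" "r < j"
  obtains e where "eval_ac e (\<alpha> j) = 1" "eval_ac e (inverse (\<alpha> j)) = 0"
proof -
  have "j \<in> {r+1..r+s}" using assms by simp
  then have "monic_reciprocal (f j) \<noteq> f j" using assms(1) disjoint_reciprocal by blast
  then have ne: "inverse_factor j \<noteq> f j" using assms(2) by (simp add: inverse_factor_def)
  obtain e where "\<And>q z. q \<in> {f j} \<Longrightarrow> eval_ac q z = 0 \<Longrightarrow> eval_ac e z = 1"
    "\<And>q z. q \<in> factors - {f j} \<Longrightarrow> eval_ac q z = 0 \<Longrightarrow> eval_ac e z = 0"
    using crt_idempotent[OF finite_factors, of "{f j}"] factors_irreducible f_in_factors[OF assms(1)]
    by blast
  then show ?thesis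
    using that root inverse_root[OF assms(1)] inverse_factor_in_factors[OF assms(1)] ne assms(1)
    by blast
qed

section \<open>The projections onto the components\<close>

lemma component_cyclic:
  assumes "j \<in> indices" "j \<le> zeta n"
  shows "component n r \<alpha> u j = Inl (cyc (coset_eval n False u (\<alpha> j)) (coset_eval n True u (\<alpha> j)))"
  using assms(2) by (simp add: component_def gamma_def Let_def coset_eval_def rational_root[OF assms]
      eval_ac_to_ac del: to_ac_1 to_ac_minus)

lemma component_cong:
  assumes j: "j \<in> indices"
    and eq: "\<And>e z. z \<in> {\<alpha> j, inverse (\<alpha> j)} \<Longrightarrow> coset_eval n e u z = coset_eval n e v z"
  shows "component n r \<alpha> u j = component n r \<alpha> v j"
proof (cases "j \<le> zeta n")
  case True
  then show ?thesis using eq by (simp add: component_cyclic[OF j])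
next
  case False
  have "tau n (\<alpha> j) u = tau n (\<alpha> j) v" using eq by (simp add: tau_eq)
  then show ?thesis using False by (simp add: component_def)
qed

lemma component_add:
  assumes "j \<in> indices"
  shows "component n r \<alpha> (u \<oplus>\<^bsub>dihedral_algebra n\<^esub> v) j =
    comp_add (component n r \<alpha> u j) (component n r \<alpha> v j)"
proof (cases "j \<le> zeta n")
  case True
  then show ?thesis
    by (simp add: component_cyclic[OF assms] comp_add_cyclic coset_eval_add del: comp_add.simps)
next
  case False
  have "tau n (\<alpha> j) (u \<oplus>\<^bsub>dihedral_algebra n\<^esub> v) = tau n (\<alpha> j) u + tau n (\<alpha> j) v"
    by (simp add: tau_eq mat2_add coset_eval_add)
  then show ?thesis using False by (simp add: component_def sigma_add)
qed

lemma component_mult: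
  assumes "j \<in> indices"
  shows "component n r \<alpha> (u \<otimes>\<^bsub>dihedral_algebra n\<^esub> v) j =
    comp_mult (component n r \<alpha> u j) (component n r \<alpha> v j)"
proof (cases "j \<le> zeta n")
  case True
  then show ?thesis
    by (simp add: component_cyclic[OF assms] cyc_mult rational_root_inverse[OF assms]
        coset_eval_mult[OF root_of_unity[OF assms] n_pos] algebra_simps)
next
  case False
  then show ?thesis
    using tau_mult[OF root_of_unity[OF assms] n_pos, of u v]
      sigma_mult[OF root_nonzero root_ne_inverse, OF assms assms]
    by (simp add: component_def)
qed

lemma component_zero:
  assumes "j \<in> indices"
  shows "zero_comp n j = {component n r \<alpha> (\<lambda>g. 0) j}"
proof (cases "j \<le> zeta n")
  case True
  then show ?thesis
    by (simp add: component_cyclic[OF assms] zero_comp_cyclic coset_eval_zero)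
next
  case False
  then show ?thesis
    by (simp add: component_def zero_comp_def tau_eq coset_eval_zero sigma_zero flip: mat2_zero)
qed

text \<open>
  For \<open>\<zeta>(n) < j \<le> r\<close> the values of \<open>P\<close> and \<open>Q\<close> at \<open>\<alpha>\<^sub>j\<close> and its inverse are linear expressions over
  \<open>F\<^sub>j\<close>, so the conjugated matrix has entries in \<open>F\<^sub>j\<close>. For \<open>j > r\<close> it suffices that the inverse of
  \<open>\<alpha>\<^sub>j\<close> lies in the field generated by \<open>\<alpha>\<^sub>j\<close>.
\<close>

lemma component_in_A:
  assumes "j \<in> indices"
  shows "component n r \<alpha> u j \<in> A_comp n r \<alpha> j"
proof -
  consider "j \<le> zeta n" | "zeta n < j" "j \<le> r" | "r < j" by linarith
  then show ?thesis
  proof cases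
    case 1
    have "coset_eval n e u (\<alpha> j) \<in> range to_ac" for e
      by (simp add: coset_eval_def rational_root[OF assms 1] eval_ac_to_ac del: to_ac_1 to_ac_minus)
    then show ?thesis using 1 by (auto simp: component_cyclic[OF assms] A_comp_cyclic)
  next
    case 2
    let ?z = "\<alpha> j"
    define \<beta> where "\<beta> = ?z + inverse ?z"
    have z: "?z \<noteq> 0" "?z \<noteq> inverse ?z"
      using root_nonzero root_ne_inverse assms 2 by auto
    note F = is_subfieldD[OF is_subfield_adjoin[of \<beta>]]
    have \<beta>: "\<beta> \<in> adjoin \<beta>" using adjoinI[of "[:0, 1:]" \<beta>] by (simp add: eval_ac_pCons)
    have FF: "F_field n r \<alpha> j = adjoin \<beta>" using 2 by (simp add: F_field_def \<beta>_def)
    obtain x y where P: "x \<in> adjoin \<beta>" "y \<in> adjoin \<beta>"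
      "eval_ac (P_poly n u) ?z = x + y * ?z" "eval_ac (P_poly n u) (inverse ?z) = x + y * inverse ?z"
      using eval_ac_reciprocal_pair[OF z(1), of "P_poly n u", folded \<beta>_def] .
    obtain v' w where Q: "v' \<in> adjoin \<beta>" "w \<in> adjoin \<beta>"
      "eval_ac (Q_poly n u) ?z = v' + w * ?z" "eval_ac (Q_poly n u) (inverse ?z) = v' + w * inverse ?z"
      using eval_ac_reciprocal_pair[OF z(1), of "Q_poly n u", folded \<beta>_def] .
    \<comment> \<open>Rewriting \<open>w \<alpha>\<^sub>j\<close> as \<open>w \<beta> - w \<alpha>\<^sub>j\<^bsup>-1\<^esup>\<close> gives \<open>Q\<close> the shape required by \<open>sigma_mat2\<close>.\<close>
    define v where "v = v' + w * \<beta>"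
    have v: "v \<in> adjoin \<beta>" using Q(1,2) \<beta> by (simp add: v_def F(3,4))
    have "tau n ?z u = mat2 (x + y * ?z) (v - w * ?z) (v - w * inverse ?z) (x + y * inverse ?z)"
      by (simp add: tau_def P(3,4) Q(3,4) v_def \<beta>_def algebra_simps)
    then have "component n r \<alpha> u j =
        Inr (mat2 (x + v) (y - \<beta> * v + w) (w - y) (x + \<beta> * y - v))"
      using 2 sigma_mat2[OF z, folded \<beta>_def] by (simp add: component_def)
    then show ?thesis
      using 2 P(1,2) Q(2) v \<beta> by (simp add: A_comp_matrix FF F)
  next
    case 3
    then have j: "zeta n < j" using zeta_le_r by simp
    have FF: "F_field n r \<alpha> j = adjoin (\<alpha> j)" using 3 j by (simp add: F_field_def)
    note F = is_subfieldD[OF is_subfield_adjoin[of "\<alpha> j"]]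
    have "inverse (\<alpha> j) \<in> adjoin (\<alpha> j)" by (rule inverse_in_adjoin_self)
    then obtain g where g: "inverse (\<alpha> j) = eval_ac g (\<alpha> j)" by (auto simp: adjoin_def)
    have "eval_ac p (inverse (\<alpha> j)) \<in> adjoin (\<alpha> j)" for p
      unfolding g eval_ac_pcompose[symmetric] by (rule adjoinI)
    then show ?thesis
      using 3 j by (simp add: component_def A_comp_matrix FF tau_def adjoinI)
  qed
qed

text \<open>
  For \<open>\<zeta>(n) < j \<le> r\<close> the four entries of a matrix determine the coefficients \<open>x\<close>, \<open>y\<close>, \<open>v\<close>, \<open>w\<close>
  by a linear system whose determinant is, up to sign, \<open>\<beta>\<^sup>2 - 4 = (\<alpha>\<^sub>j - \<alpha>\<^sub>j\<^bsup>-1\<^esup>)\<^sup>2\<close>. For \<open>j > r\<close> the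
  entries are four independent values of \<open>P\<close> and \<open>Q\<close>.
\<close>

lemma component_surj:
  assumes j: "j \<in> indices" and a: "a \<in> A_comp n r \<alpha> j"
  obtains u where "u \<in> carrier (dihedral_algebra n)" "component n r \<alpha> u j = a"
proof -
  let ?z = "\<alpha> j"
  have z0: "?z \<noteq> 0" and zn: "?z ^ n = 1" and zn': "inverse ?z ^ n = 1"
    using j by (simp_all add: root_nonzero root_of_unity inverse_root_of_unity)
  have inv_pow: "?z ^ (n - 1) = inverse ?z" "inverse ?z ^ (n - 1) = ?z"
    using zn zn' z0 n_pos by (simp_all add: power_diff power_inverse divide_inverse)
  consider "j \<le> zeta n" | "zeta n < j" "j \<le> r" | "r < j" by linarith
  then show ?thesis
  proof cases
    case 1
    then obtain b c where a_eq: "a = Inl (cyc (to_ac b) (to_ac c))"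
      using a by (auto simp: A_comp_cyclic)
    obtain u where u: "u \<in> carrier (dihedral_algebra n)"
      "\<And>z. z ^ n = 1 \<Longrightarrow> coset_eval n False u z = eval_ac [:b:] z"
      "\<And>z. z ^ n = 1 \<Longrightarrow> coset_eval n True u z = eval_ac [:c:] z"
      using ex_dihedral_element[OF n_pos, where p = "[:b:]" and q = "[:c:]"] by blast
    show ?thesis
      by (rule that[OF u(1)])
         (simp add: component_cyclic[OF j 1] u(2,3)[OF zn] eval_ac_pCons a_eq)
  next
    case 2
    define \<beta> where "\<beta> = ?z + inverse ?z"
    have z: "?z \<noteq> inverse ?z"
      using root_ne_inverse j 2 by auto
    note F = is_subfieldD[OF is_subfield_adjoin[of \<beta>]]
    have \<beta>: "\<beta> \<in> adjoin \<beta>" using adjoinI[of "[:0, 1:]" \<beta>] by (simp add: eval_ac_pCons)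
    have FF: "F_field n r \<alpha> j = adjoin \<beta>" using 2 by (simp add: F_field_def \<beta>_def)
    obtain m11 m12 m21 m22 where a_eq: "a = Inr (mat2 m11 m12 m21 m22)"
      and m: "m11 \<in> adjoin \<beta>" "m12 \<in> adjoin \<beta>" "m21 \<in> adjoin \<beta>" "m22 \<in> adjoin \<beta>"
      using a unfolding A_comp_matrix[OF 2(1)] FF by blast
    \<comment> \<open>The constant 4 is written as a sum of ones so that closure of the subfield applies to it.\<close>
    define D where "D = \<beta> * \<beta> - (1 + 1 + 1 + 1)"
    have "D = (?z - inverse ?z) * (?z - inverse ?z)"
      using z0 by (simp add: D_def \<beta>_def algebra_simps)
    then have D0: "D \<noteq> 0" using z by simp
    have D: "D \<in> adjoin \<beta>" using \<beta> by (simp only: D_def F)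
    \<comment> \<open>Solution of \<open>2 y - \<beta> v = m12 - m21\<close> and \<open>\<beta> y - 2 v = m22 - m11\<close> by Cramer's rule.\<close>
    define y where "y = (\<beta> * (m22 - m11) - (1 + 1) * (m12 - m21)) / D"
    define v where "v = ((1 + 1) * (m22 - m11) - \<beta> * (m12 - m21)) / D"
    define w where "w = m21 + y"
    define x where "x = m11 - v"
    have y: "y \<in> adjoin \<beta>" and v: "v \<in> adjoin \<beta>"
      unfolding y_def v_def using m \<beta> D by (simp_all only: F)
    have w: "w \<in> adjoin \<beta>" and x: "x \<in> adjoin \<beta>"
      unfolding w_def x_def using y v m by (simp_all only: F)
    have Dy: "D * y = \<beta> * (m22 - m11) - (1 + 1) * (m12 - m21)"
      and Dv: "D * v = (1 + 1) * (m22 - m11) - \<beta> * (m12 - m21)"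
      using D0 by (simp_all add: y_def v_def)
    have "D * (y - \<beta> * v + w) = (1 + 1) * (D * y) - \<beta> * (D * v) + D * m21"
      by (simp add: w_def algebra_simps)
    also have "\<dots> = D * m12" unfolding Dy Dv by (simp add: D_def algebra_simps)
    finally have e12: "y - \<beta> * v + w = m12" using D0 by simp
    have "D * (x + \<beta> * y - v) = D * m11 + \<beta> * (D * y) - (1 + 1) * (D * v)"
      by (simp add: x_def algebra_simps)
    also have "\<dots> = D * m22" unfolding Dy Dv by (simp add: D_def algebra_simps)
    finally have e22: "x + \<beta> * y - v = m22" using D0 by simp
    obtain px py pv pw where p: "x = eval_ac px \<beta>" "y = eval_ac py \<beta>" "v = eval_ac pv \<beta>"
      "w = eval_ac pw \<beta>" using x y v w unfolding adjoin_def by blast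
    \<comment> \<open>The polynomial \<open>X + X\<^bsup>n-1\<^esup>\<close> takes the value \<open>\<beta>\<close> both at \<open>\<alpha>\<^sub>j\<close> and at its inverse.\<close>
    let ?b = "[:0, 1:] + Polynomial.monom 1 (n - 1) :: 'a poly"
    have b: "eval_ac ?b ?z = \<beta>" "eval_ac ?b (inverse ?z) = \<beta>"
      by (simp_all add: eval_ac_add eval_ac_pCons eval_ac_monom inv_pow \<beta>_def add.commute
          del: One_nat_def)
    let ?P = "pcompose px ?b + pcompose py ?b * [:0, 1:]"
    let ?Q = "pcompose pv ?b - pcompose pw ?b * Polynomial.monom 1 (n - 1)"
    obtain u where u: "u \<in> carrier (dihedral_algebra n)"
      "\<And>z. z ^ n = 1 \<Longrightarrow> coset_eval n False u z = eval_ac ?P z"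
      "\<And>z. z ^ n = 1 \<Longrightarrow> coset_eval n True u z = eval_ac ?Q z"
      using ex_dihedral_element[OF n_pos, where p = ?P and q = ?Q] by blast
    have X: "eval_ac [:0, 1:] t = t" for t :: "'a alg_closure" by (simp add: eval_ac_pCons)
    have "tau n ?z u = mat2 (x + y * ?z) (v - w * ?z) (v - w * inverse ?z) (x + y * inverse ?z)"
      unfolding tau_eq u(2,3)[OF zn] u(2,3)[OF zn'] eval_ac_add[of "_ \<circ>\<^sub>p _"] eval_ac_diff
        eval_ac_mult eval_ac_pcompose b X eval_ac_monom inv_pow
      by (simp add: p)
    then have "component n r \<alpha> u j =
        Inr (mat2 (x + v) (y - \<beta> * v + w) (w - y) (x + \<beta> * y - v))"
      using 2 sigma_mat2[OF z0 z, folded \<beta>_def] by (simp add: component_def)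
    then have "component n r \<alpha> u j = a"
      unfolding a_eq e12 e22 by (simp add: x_def w_def)
    then show ?thesis by (rule that[OF u(1)])
  next
    case 3
    then have jz: "zeta n < j" using zeta_le_r by simp
    have FF: "F_field n r \<alpha> j = adjoin ?z" using 3 jz by (simp add: F_field_def)
    obtain p11 p12 p21 p22 where a_eq:
      "a = Inr (mat2 (eval_ac p11 ?z) (eval_ac p12 ?z) (eval_ac p21 ?z) (eval_ac p22 ?z))"
      using a unfolding A_comp_matrix[OF jz] FF adjoin_def by blast
    obtain e where e: "eval_ac e ?z = 1" "eval_ac e (inverse ?z) = 0"
      using separate_root_from_inverse[OF j 3] .
    \<comment> \<open>Composing \<open>q\<close> with \<open>X\<^bsup>n-1\<^esup>\<close> moves its value at \<open>\<alpha>\<^sub>j\<close> to the inverse of \<open>\<alpha>\<^sub>j\<close>.\<close>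
    let ?glue = "\<lambda>p q. e * p + (1 - e) * pcompose q (Polynomial.monom 1 (n - 1))"
    have glue: "eval_ac (?glue p q) ?z = eval_ac p ?z"
      "eval_ac (?glue p q) (inverse ?z) = eval_ac q ?z" for p q
      unfolding eval_ac_add eval_ac_mult eval_ac_diff eval_ac_pcompose eval_ac_monom
      using e inv_pow by simp_all
    obtain u where u: "u \<in> carrier (dihedral_algebra n)"
      "\<And>z. z ^ n = 1 \<Longrightarrow> coset_eval n False u z = eval_ac (?glue p11 p22) z"
      "\<And>z. z ^ n = 1 \<Longrightarrow> coset_eval n True u z = eval_ac (?glue p21 p12) z"
      using ex_dihedral_element[OF n_pos, where p = "?glue p11 p22" and q = "?glue p21 p12"] by blast
    have "tau n ?z u =
        mat2 (eval_ac p11 ?z) (eval_ac p12 ?z) (eval_ac p21 ?z) (eval_ac p22 ?z)"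
      unfolding tau_eq u(2,3)[OF zn] u(2,3)[OF zn'] glue ..
    then have "component n r \<alpha> u j = a" using 3 jz by (simp add: component_def a_eq)
    then show ?thesis by (rule that[OF u(1)])
  qed
qed

lemma component_projector:
  assumes j: "j \<in> indices"
  obtains e where "e \<in> carrier (dihedral_algebra n)"
    "\<And>u k. k \<in> indices \<Longrightarrow> component n r \<alpha> (e \<otimes>\<^bsub>dihedral_algebra n\<^esub> u) k =
      component n r \<alpha> (if k = j then u else (\<lambda>g. 0)) k"
proof -
  obtain p where p: "\<And>k z. k \<in> indices \<Longrightarrow> z \<in> {\<alpha> k, inverse (\<alpha> k)} \<Longrightarrow>
      eval_ac p z = (if k = j then 1 else 0)"
    using index_idempotent[OF j] by blast
  obtain e where e: "e \<in> carrier (dihedral_algebra n)"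
    "\<And>z. z ^ n = 1 \<Longrightarrow> coset_eval n False e z = eval_ac p z"
    "\<And>z. z ^ n = 1 \<Longrightarrow> coset_eval n True e z = eval_ac 0 z"
    using ex_dihedral_element[OF n_pos, where p = p and q = 0] by blast
  show ?thesis
  proof (rule that[OF e(1)])
    fix u k assume k: "k \<in> indices"
    have "coset_eval n d (e \<otimes>\<^bsub>dihedral_algebra n\<^esub> u) z =
        coset_eval n d (if k = j then u else (\<lambda>g. 0)) z"
      if z: "z \<in> {\<alpha> k, inverse (\<alpha> k)}" for d z
    proof -
      have zn: "z ^ n = 1" "inverse z ^ n = 1"
        using z root_of_unity[OF k] by (auto simp: power_inverse)
      have "inverse z \<in> {\<alpha> k, inverse (\<alpha> k)}" using z by auto
      note pz = p[OF k z] p[OF k this]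
      show ?thesis
        by (cases d)
           (simp_all add: coset_eval_mult[OF zn(1) n_pos] e(2,3)[OF zn(1)] e(2,3)[OF zn(2)] pz
             coset_eval_zero)
    qed
    then show "component n r \<alpha> (e \<otimes>\<^bsub>dihedral_algebra n\<^esub> u) k =
        component n r \<alpha> (if k = j then u else (\<lambda>g. 0)) k"
      by (rule component_cong[OF k])
  qed
qed

lemma dihedral_code_iff:
  fixes I :: "(bool \<times> int \<Rightarrow> 'a) set"
  shows "dihedral_code n I \<longleftrightarrow>
    I \<subseteq> carrier (dihedral_algebra n) \<and> (\<lambda>g. 0) \<in> I \<and>
    (\<forall>u\<in>I. \<forall>v\<in>I. u \<oplus>\<^bsub>dihedral_algebra n\<^esub> v \<in> I) \<and>
    (\<forall>u\<in>carrier (dihedral_algebra n). \<forall>v\<in>I. u \<otimes>\<^bsub>dihedral_algebra n\<^esub> v \<in> I)"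
  unfolding dihedral_code_def
  by (rule left_ideal_group_algebra_iff[OF group_dihedral_group[OF n_pos] finite_carrier_dihedral])

text \<open>
  Closure under multiplication by all of \<open>A\<^sub>j\<close> is where surjectivity of the projection is used: every
  multiplier is the image of an element of the group algebra, and \<open>I\<close> absorbs the latter.
\<close>

lemma code_component_left_ideal:
  assumes I: "dihedral_code n I" and j: "j \<in> indices"
  shows "comp_left_ideal n r \<alpha> j ((\<lambda>u. component n r \<alpha> u j) ` I)"
proof -
  note I' = I[unfolded dihedral_code_iff]
  have "comp_mult a (component n r \<alpha> u j) \<in> (\<lambda>u. component n r \<alpha> u j) ` I"
    if a: "a \<in> A_comp n r \<alpha> j" and u: "u \<in> I" for a u
  proof -
    obtain v where "v \<in> carrier (dihedral_algebra n)" "component n r \<alpha> v j = a"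
      using component_surj[OF j a] .
    then show ?thesis
      using I' u component_mult[OF j, of v u] by (metis image_eqI)
  qed
  moreover have "comp_add (component n r \<alpha> u j) (component n r \<alpha> v j) \<in> (\<lambda>u. component n r \<alpha> u j) ` I"
    if "u \<in> I" "v \<in> I" for u v
    using I' that component_add[OF j, of u v] by (metis image_eqI)
  moreover have "zero_comp n j \<subseteq> (\<lambda>u. component n r \<alpha> u j) ` I"
    using I' by (simp add: component_zero[OF j])
  moreover have "(\<lambda>u. component n r \<alpha> u j) ` I \<subseteq> A_comp n r \<alpha> j"
    using component_in_A[OF j] by blast
  ultimately show ?thesis unfolding comp_left_ideal_def by blast
qed

text \<open>
  An element of the product whose \<open>j\<close>-th entry comes from \<open>w\<^sub>j \<in> I\<close> is the image of \<open>\<Sum>\<^sub>j e\<^sub>j w\<^sub>j\<close>,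
  where \<open>e\<^sub>j\<close> projects onto the \<open>j\<close>-th component; this sum lies in \<open>I\<close> because \<open>I\<close> is a left ideal.
\<close>

lemma P_map_image_code:
  assumes I: "dihedral_code n I"
  shows "P_map n r s \<alpha> ` I = PiE indices (\<lambda>j. (\<lambda>u. component n r \<alpha> u j) ` I)"
proof
  show "P_map n r s \<alpha> ` I \<subseteq> PiE indices (\<lambda>j. (\<lambda>u. component n r \<alpha> u j) ` I)"
    by (auto simp: P_map_eq_restrict)
next
  note I' = I[unfolded dihedral_code_iff]
  show "PiE indices (\<lambda>j. (\<lambda>u. component n r \<alpha> u j) ` I) \<subseteq> P_map n r s \<alpha> ` I"
  proof
    fix g assume g: "g \<in> PiE indices (\<lambda>j. (\<lambda>u. component n r \<alpha> u j) ` I)"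
    then have "\<forall>j\<in>indices. \<exists>w\<in>I. g j = component n r \<alpha> w j" by (auto simp: PiE_iff)
    then obtain w where w: "\<And>j. j \<in> indices \<Longrightarrow> w j \<in> I \<and> g j = component n r \<alpha> (w j) j"
      by metis
    have "\<exists>u\<in>I. \<forall>k\<in>indices. component n r \<alpha> u k = component n r \<alpha> (if k \<in> S then w k else (\<lambda>g. 0)) k"
      if "S \<subseteq> indices" for S
      using finite_subset[OF that finite_atLeastAtMost] that
    proof (induction S rule: finite_induct)
      case empty
      then show ?case using I' by (intro bexI[of _ "\<lambda>g. 0"]) auto
    next
      case (insert j S)
      then obtain u where u: "u \<in> I" "\<And>k. k \<in> indices \<Longrightarrow>
          component n r \<alpha> u k = component n r \<alpha> (if k \<in> S then w k else (\<lambda>g. 0)) k" by blast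
      have j: "j \<in> indices" using insert by simp
      obtain e where e: "e \<in> carrier (dihedral_algebra n)"
        "\<And>u k. k \<in> indices \<Longrightarrow> component n r \<alpha> (e \<otimes>\<^bsub>dihedral_algebra n\<^esub> u) k =
          component n r \<alpha> (if k = j then u else (\<lambda>g. 0)) k"
        using component_projector[OF j] by blast
      let ?u = "u \<oplus>\<^bsub>dihedral_algebra n\<^esub> (e \<otimes>\<^bsub>dihedral_algebra n\<^esub> w j)"
      have "?u \<in> I" using I' u(1) e(1) w[OF j] by blast
      moreover have "component n r \<alpha> ?u k =
          component n r \<alpha> (if k \<in> insert j S then w k else (\<lambda>g. 0)) k" if k: "k \<in> indices" for k
      proof -
        have "component n r \<alpha> ?u k = component n r \<alpha>
            ((if k \<in> S then w k else (\<lambda>g. 0)) \<oplus>\<^bsub>dihedral_algebra n\<^esub> (if k = j then w j else (\<lambda>g. 0))) k"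
          unfolding component_add[OF k] u(2)[OF k] e(2)[OF k] ..
        then show ?thesis using insert.hyps(2) by (auto simp: group_algebra_add)
      qed
      ultimately show ?case by blast
    qed
    from this[OF subset_refl] obtain u where u: "u \<in> I"
      "\<And>k. k \<in> indices \<Longrightarrow> component n r \<alpha> u k = g k" using w by auto
    have "g = P_map n r s \<alpha> u"
      using g u(2) by (auto simp: P_map_eq_restrict fun_eq_iff PiE_iff extensional_def)
    then show "g \<in> P_map n r s \<alpha> ` I" using u(1) by blast
  qed
qed

lemma preimage_is_code:
  assumes B: "\<And>j. j \<in> indices \<Longrightarrow> comp_left_ideal n r \<alpha> j (B j)"
  shows "dihedral_code n {u \<in> carrier (dihedral_algebra n). P_map n r s \<alpha> u \<in> PiE indices B}"
proof -
  have mem: "P_map n r s \<alpha> u \<in> PiE indices B \<longleftrightarrow> (\<forall>j\<in>indices. component n r \<alpha> u j \<in> B j)" for u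
    by (auto simp: P_map_eq_restrict PiE_iff)
  have "component n r \<alpha> (\<lambda>g. 0) j \<in> B j" if "j \<in> indices" for j
    using B[OF that] component_zero[OF that] by (simp add: comp_left_ideal_def)
  moreover have "component n r \<alpha> (u \<oplus>\<^bsub>dihedral_algebra n\<^esub> v) j \<in> B j"
    if "j \<in> indices" "component n r \<alpha> u j \<in> B j" "component n r \<alpha> v j \<in> B j" for u v j
    using B[OF that(1)] that(2,3) by (simp add: component_add[OF that(1)] comp_left_ideal_def)
  moreover have "component n r \<alpha> (u \<otimes>\<^bsub>dihedral_algebra n\<^esub> v) j \<in> B j"
    if "j \<in> indices" "component n r \<alpha> v j \<in> B j" for u v j
    using B[OF that(1)] that(2) component_in_A[OF that(1), of u]
    by (simp add: component_mult[OF that(1)] comp_left_ideal_def)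
  moreover have "u \<oplus>\<^bsub>dihedral_algebra n\<^esub> v \<in> carrier (dihedral_algebra n)"
    if "u \<in> carrier (dihedral_algebra n)" "v \<in> carrier (dihedral_algebra n)"
    for u v :: "bool \<times> int \<Rightarrow> 'a"
    using that by (simp add: group_algebra_carrier_iff group_algebra_add)
  moreover have "(\<lambda>g. 0) \<in> carrier (dihedral_algebra n :: (bool \<times> int \<Rightarrow> 'a) ring)"
    by (simp add: group_algebra_carrier_iff)
  ultimately show ?thesis
    unfolding dihedral_code_iff mem by (simp add: group_algebra_mult_closed)
qed

end

section \<open>Classification of dihedral codes\<close>

lemma comp_left_ideal_cases:
  fixes \<alpha> :: "nat \<Rightarrow> 'a::{field,finite} alg_closure"
  assumes "comp_left_ideal n r \<alpha> j L"
  obtains "L = A_comp n r \<alpha> j" | "L = I_comp n r \<alpha> j 0 1" "j \<le> zeta n \<longrightarrow> odd CARD('a)"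
  | "L = I_comp n r \<alpha> j 1 0"
  | x where "zeta n < j" "x \<in> F_field n r \<alpha> j" "x \<noteq> 0" "L = I_comp n r \<alpha> j (- x) 1"
  | "L = zero_comp n j"
proof (cases "j \<le> zeta n")
  case True
  then show ?thesis using comp_left_ideal_cyclic_cases[OF assms True] that(1,2,3,5) by blast
next
  case False
  then have "zeta n < j" by simp
  then show ?thesis using comp_left_ideal_matrix_cases[OF assms] that False by blast
qed

theorem theorem3:
  fixes n r s :: nat
    and f :: "nat \<Rightarrow> 'a::{field,finite} poly"
    and \<alpha> :: "nat \<Rightarrow> 'a alg_closure"
  assumes "n \<ge> 2" and "coprime CARD('a) n"
    and "dihedral_factorization n r s f"
    and "\<forall>j\<in>{1..r+s}. eval_ac (f j) (\<alpha> j) = 0"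
  shows
    "(\<forall>I :: (bool \<times> int \<Rightarrow> 'a) set. dihedral_code n I \<longrightarrow>
       (\<exists>J1 J2 J3 J4 x.
          J1 \<subseteq> {1..r+s} \<and> J2 \<subseteq> {1..r+s} \<and> J3 \<subseteq> {1..r+s} \<and> J4 \<subseteq> {zeta n + 1..r+s} \<and>
          J1 \<inter> J2 = {} \<and> J1 \<inter> J3 = {} \<and> J1 \<inter> J4 = {} \<and>
          J2 \<inter> J3 = {} \<and> J2 \<inter> J4 = {} \<and> J3 \<inter> J4 = {} \<and>
          (even CARD('a) \<longrightarrow> 1 \<notin> J2) \<and>
          (\<forall>j\<in>J4. x j \<in> F_field n r \<alpha> j \<and> x j \<noteq> 0) \<and>
          P_map n r s \<alpha> ` I =
            PiE {1..r+s} (\<lambda>j.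
              if j \<in> J1 then A_comp n r \<alpha> j
              else if j \<in> J2 then I_comp n r \<alpha> j 0 1
              else if j \<in> J3 then I_comp n r \<alpha> j 1 0
              else if j \<in> J4 then I_comp n r \<alpha> j (- x j) 1
              else zero_comp n j))) \<and>
     (\<forall>x y B.
        (\<forall>j\<in>{1..r+s}. x j \<in> F_field n r \<alpha> j \<and> y j \<in> F_field n r \<alpha> j) \<longrightarrow>
        (\<forall>j\<in>{1..r+s}. B j = A_comp n r \<alpha> j \<or> B j = I_comp n r \<alpha> j (x j) (y j)
                       \<or> B j = zero_comp n j) \<longrightarrow>
        dihedral_code n {u \<in> carrier (dihedral_algebra n). P_map n r s \<alpha> u \<in> PiE {1..r+s} B})"
proof -
  interpret dihedral_decomposition n r s f \<alpha>
    using assms by unfold_locales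
  show ?thesis
  proof (intro conjI allI impI)
    fix I :: "(bool \<times> int \<Rightarrow> 'a) set"
    assume I: "dihedral_code n I"
    define L where "L j = (\<lambda>u. component n r \<alpha> u j) ` I" for j
    \<comment> \<open>Excluding the earlier sets makes disjointness hold by construction, whichever ideals coincide.\<close>
    define J1 where "J1 = {j \<in> indices. L j = A_comp n r \<alpha> j}"
    define J2 where "J2 = {j \<in> indices - J1. L j = I_comp n r \<alpha> j 0 1 \<and> (j \<le> zeta n \<longrightarrow> odd CARD('a))}"
    define J3 where "J3 = {j \<in> indices - J1 - J2. L j = I_comp n r \<alpha> j 1 0}"
    define good where "good j x \<longleftrightarrow> x \<in> F_field n r \<alpha> j \<and> x \<noteq> 0 \<and> L j = I_comp n r \<alpha> j (- x) 1" for j x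
    define J4 where "J4 = {j \<in> indices - J1 - J2 - J3. zeta n < j \<and> (\<exists>x. good j x)}"
    define x where "x j = (SOME x. good j x)" for j
    have x: "good j (x j)" if "j \<in> J4" for j
      using that unfolding x_def J4_def by (auto intro: someI_ex)
    have L_eq: "L j = (if j \<in> J1 then A_comp n r \<alpha> j
              else if j \<in> J2 then I_comp n r \<alpha> j 0 1
              else if j \<in> J3 then I_comp n r \<alpha> j 1 0
              else if j \<in> J4 then I_comp n r \<alpha> j (- x j) 1
              else zero_comp n j)" if j: "j \<in> indices" for j
    proof -
      have ideal: "comp_left_ideal n r \<alpha> j (L j)"
        unfolding L_def by (rule code_component_left_ideal[OF I j])
      have "j \<in> J1 \<or> j \<in> J2 \<or> j \<in> J3 \<or> j \<in> J4 \<or> L j = zero_comp n j"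
        by (rule comp_left_ideal_cases[OF ideal])
           (use j in \<open>unfold J1_def J2_def J3_def J4_def good_def, blast+\<close>)
      moreover have "j \<in> J1 \<Longrightarrow> L j = A_comp n r \<alpha> j" unfolding J1_def by blast
      moreover have "j \<in> J2 \<Longrightarrow> L j = I_comp n r \<alpha> j 0 1" unfolding J2_def by blast
      moreover have "j \<in> J3 \<Longrightarrow> L j = I_comp n r \<alpha> j 1 0" unfolding J3_def by blast
      moreover have "j \<in> J4 \<Longrightarrow> L j = I_comp n r \<alpha> j (- x j) 1" using x unfolding good_def by blast
      ultimately show ?thesis by (simp only: if_split) blast
    qed
    have "1 \<le> zeta n" by (simp add: zeta_def)
    then have J2_even: "even CARD('a) \<longrightarrow> 1 \<notin> J2" by (simp add: J2_def)
    have "P_map n r s \<alpha> ` I = PiE indices L"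
      unfolding L_def by (rule P_map_image_code[OF I])
    then have image: "P_map n r s \<alpha> ` I = PiE indices (\<lambda>j.
              if j \<in> J1 then A_comp n r \<alpha> j
              else if j \<in> J2 then I_comp n r \<alpha> j 0 1
              else if j \<in> J3 then I_comp n r \<alpha> j 1 0
              else if j \<in> J4 then I_comp n r \<alpha> j (- x j) 1
              else zero_comp n j)"
      by (simp only: L_eq cong: PiE_cong)
    have subsets: "J1 \<subseteq> indices" "J2 \<subseteq> indices - J1" "J3 \<subseteq> indices - J1 - J2"
      "J4 \<subseteq> indices - J1 - J2 - J3"
      unfolding J1_def J2_def J3_def J4_def by blast+
    then have disjoint: "J1 \<inter> J2 = {}" "J1 \<inter> J3 = {}" "J1 \<inter> J4 = {}" "J2 \<inter> J3 = {}"
      "J2 \<inter> J4 = {}" "J3 \<inter> J4 = {}" "J2 \<subseteq> indices" "J3 \<subseteq> indices" by blast+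
    have J4_range: "J4 \<subseteq> {zeta n + 1..r+s}" unfolding J4_def by auto
    have x_J4: "\<forall>j\<in>J4. x j \<in> F_field n r \<alpha> j \<and> x j \<noteq> 0" using x unfolding good_def by blast
    show "\<exists>J1 J2 J3 J4 x.
          J1 \<subseteq> {1..r+s} \<and> J2 \<subseteq> {1..r+s} \<and> J3 \<subseteq> {1..r+s} \<and> J4 \<subseteq> {zeta n + 1..r+s} \<and>
          J1 \<inter> J2 = {} \<and> J1 \<inter> J3 = {} \<and> J1 \<inter> J4 = {} \<and>
          J2 \<inter> J3 = {} \<and> J2 \<inter> J4 = {} \<and> J3 \<inter> J4 = {} \<and>
          (even CARD('a) \<longrightarrow> 1 \<notin> J2) \<and>
          (\<forall>j\<in>J4. x j \<in> F_field n r \<alpha> j \<and> x j \<noteq> 0) \<and>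
          P_map n r s \<alpha> ` I =
            PiE {1..r+s} (\<lambda>j.
              if j \<in> J1 then A_comp n r \<alpha> j
              else if j \<in> J2 then I_comp n r \<alpha> j 0 1
              else if j \<in> J3 then I_comp n r \<alpha> j 1 0
              else if j \<in> J4 then I_comp n r \<alpha> j (- x j) 1
              else zero_comp n j)"
      by (rule exI[of _ J1], rule exI[of _ J2], rule exI[of _ J3], rule exI[of _ J4],
          rule exI[of _ x], intro conjI subsets(1) disjoint J4_range J2_even x_J4 image)
  next
    fix x y :: "nat \<Rightarrow> 'a alg_closure" and B
    assume xy: "\<forall>j\<in>{1..r+s}. x j \<in> F_field n r \<alpha> j \<and> y j \<in> F_field n r \<alpha> j"
      and B: "\<forall>j\<in>{1..r+s}. B j = A_comp n r \<alpha> j \<or> B j = I_comp n r \<alpha> j (x j) (y j)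
                       \<or> B j = zero_comp n j"
    have "comp_left_ideal n r \<alpha> j (B j)" if "j \<in> indices" for j
      using B[rule_format, OF that] xy[rule_format, OF that] comp_left_ideal_A comp_left_ideal_zero
        comp_left_ideal_I by metis
    then show "dihedral_code n {u \<in> carrier (dihedral_algebra n). P_map n r s \<alpha> u \<in> PiE {1..r+s} B}"
      by (rule preimage_is_code)
  qed
qed

end
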